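(* Assume $H_0s_0+h_0=0$. Let $(x,u)$ be the trajectory $x_i=T_iz_i+t_i$, $u_i=Y_iz_i+Z_iv_i+y_i$ recovered from an optimum (minimizer) $(z,v)$ of the reduced LQR problem. Then the contraction–expansion procedure described in the context, applied to $(x,u)$, returns multipliers $\lambda_1,\ldots,\lambda_N$, $\mu_0,\ldots,\mu_{N-1}$, $\eta_0,\ldots,\eta_N$, $\alpha$ which together with $(x,u)$ satisfy all KKT equations of the original equality-constrained LQR problem. (In particular all the solves in the procedure are solvable.)
   Context: Original problem: a horizon $N\ge1$, state dimensions $n_0,\ldots,n_N$, control dimensions $m_0,\ldots,m_{N-1}$ (possibly varying by stage), real data of compatible sizes with $Q_i$ and $R_i$ symmetric (no definiteness assumed), $s_0\in\mathbb R^{n_0}$, and $$\begin{aligned}\min_{x,u}\ &\sum_{i=0}^{N-1}\ell_i(x_i,u_i)+\tfrac12x_N^{\top}Q_Nx_N+q_N^{\top}x_N\\ \text{s.t. }&x_0=s_0,\\ &x_{i+1}=A_ix_i+B_iu_i+c_i,\quad C_ix_i+D_iu_i+d_i=0\quad(i=0,\ldots,N-1),\\ &E_ix_i+e_i=0\quad(i=0,\ldots,N),\end{aligned}$$ where $\ell_i(x,u)=\tfrac12x^{\top}Q_ix+x^{\top}M_iu+\tfrac12u^{\top}R_iu+q_i^{\top}x+r_i^{\top}u$. Empty matrices represent absent constraints; no rank assumptions are made on the constraints. Suffix domains: $\mathcal X_i\subseteq\mathbb R^{n_i}$ is the set of $x_i$ from which there exist controls $u_i,\ldots,u_{N-1}$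 and states $x_{i+1},\ldots,x_N$ satisfying the dynamics, mixed and state constraints at stages $i,\ldots,N-1$ and the terminal constraint $E_Nx_N+e_N=0$ (the initial condition is not imposed). It is an affine set represented as $\mathcal X_i=\{x_i:H_ix_i+h_i=0\}$ for some chosen $H_i,h_i$. The condition $H_0s_0+h_0=0$ means $s_0\in\mathcal X_0$ and implies that all $\mathcal X_i$ are nonempty. Choose $t_i$ with $H_it_i+h_i=0$, $T_i\in\mathbb R^{n_i\times\bar n_i}$ whose columns form a basis of the null space of $H_i$, and any left inverse $S_i$ of $T_i$ ($S_iT_i=I_{\bar n_i}$). Controls: for $i=0,\ldots,N-1$ let $$\Gamma_i=\begin{bmatrix}D_i\\H_{i+1}B_i\end{bmatrix},\quad \Phi_i=\begin{bmatrix}C_iT_i\\H_{i+1}A_iT_i\end{bmatrix},\quad \gamma_i=\begin{bmatrix}C_it_i+d_i\\H_{i+1}(A_it_i+c_i)+h_{i+1}\end{bmatrix}.$$ Choose $Y_i,Z_i,y_i$ such that the columns of $Z_i\in\mathbb R^{m_i\times\bar m_i}$ form a basis of the null space of $\Gamma_i$ and, for every $z_i$, the solution set of $\Gamma_iu_i+\Phi_iz_i+\gamma_i=0$ is exactly $\{Y_iz_i+Z_iv_i+y_i:v_i\in\mathbb R^{\bar m_i}\}$ (such a choice always exists here). Reduced data: $$\bar A_i=S_{i+1}(A_iT_i+B_iY_i),\quad \bar B_i=S_{i+1}B_iZ_i,\quad \bar c_i=S_{i+1}(A_it_i+B_iy_i+c_i-t_{i+1}),$$ $$Q_i^z=T_i^{\top}Q_iT_i,\quad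 M_i^z=T_i^{\top}M_i,\quad q_i^z=T_i^{\top}(Q_it_i+q_i),\quad r_i^z=M_i^{\top}t_i+r_i,$$ $$\bar Q_i=Q_i^z+M_i^zY_i+Y_i^{\top}(M_i^z)^{\top}+Y_i^{\top}R_iY_i,\quad \bar M_i=M_i^zZ_i+Y_i^{\top}R_iZ_i,\quad \bar R_i=Z_i^{\top}R_iZ_i,$$ $$\bar q_i=q_i^z+M_i^zy_i+Y_i^{\top}(R_iy_i+r_i^z),\quad \bar r_i=Z_i^{\top}(R_iy_i+r_i^z)$$ for $i=0,\ldots,N-1$, and $\bar Q_N=T_N^{\top}Q_NT_N$, $\bar q_N=T_N^{\top}(Q_Nt_N+q_N)$. Reduced LQR problem: minimize $$\sum_{i=0}^{N-1}\Big(\tfrac12z_i^{\top}\bar Q_iz_i+z_i^{\top}\bar M_iv_i+\tfrac12v_i^{\top}\bar R_iv_i+\bar q_i^{\top}z_i+\bar r_i^{\top}v_i\Big)+\tfrac12z_N^{\top}\bar Q_Nz_N+\bar q_N^{\top}z_N$$ over $z_i\in\mathbb R^{\bar n_i}$, $v_i\in\mathbb R^{\bar m_i}$ subject only to $z_0=S_0(s_0-t_0)$ and $z_{i+1}=\bar A_iz_i+\bar B_iv_i+\bar c_i$ for $i=0,\ldots,N-1$. KKT equations of the original problem: use multipliers $\lambda_{i+1}$ for the dynamics residual $A_ix_i+B_iu_i+c_i-x_{i+1}=0$, $\mu_i$ for $C_ix_i+D_iu_i+d_i=0$, $\eta_i$ for $E_ix_i+e_i=0$, and $\alpha$ for $x_0-s_0=0$.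 Put $g_i^x=Q_ix_i+M_iu_i+q_i$, $g_i^u=M_i^{\top}x_i+R_iu_i+r_i$ ($i<N$), $g_N^x=Q_Nx_N+q_N$. Introducing a formal $\lambda_0$ with $\alpha=-\lambda_0$, the KKT equations are primal feasibility of $(x,u)$ together with, for $i=0,\ldots,N-1$, $$g_i^x-\lambda_i+A_i^{\top}\lambda_{i+1}+C_i^{\top}\mu_i+E_i^{\top}\eta_i=0,\qquad g_i^u+B_i^{\top}\lambda_{i+1}+D_i^{\top}\mu_i=0,\qquad(\ast)$$ and terminal stationarity $$g_N^x-\lambda_N+E_N^{\top}\eta_N=0.\qquad(\ast\ast)$$ Contraction–expansion procedure, given $(x,u)$. Relations are composed by $\mathcal R_{ab}\circ\mathcal R_{bc}=\{(a,c):\exists b,\ (a,b)\in\mathcal R_{ab},\ (b,c)\in\mathcal R_{bc}\}$, which is associative. 1. For $i=0,\ldots,N-1$ let $\mathcal D_i$ be the affine relation of all pairs $(\lambda_i,\lambda_{i+1})$ for which there exist $(\mu_i,\eta_i)$ satisfying $(\ast)$ at stage $i$; let $\mathcal D_N$ be the set of all $\lambda_N$ for which there exists $\eta_N$ satisfying $(\ast\ast)$, regarded as a relation from $\lambda_N$ to a zero-dimensional dummy endpoint. 2. Contraction: compose $\mathcal D_0,\ldots,\mathcal D_N$ along a balanced binary tree whose ordered leaves are these relations. At each internal node, which composes two adjacent interval relations with endpoints $(\lambda_a,\lambda_j)$ and $(\lambda_j,\lambda_b)$, eliminate the shared costate $\lambda_j$ and store a solution map $\lambda_j=P_j\begin{bmatrix}\lambda_a\\\lambda_b\end{bmatrix}+p_j+Z_j^{\lambda}\rho_j$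 that, for every $(\lambda_a,\lambda_b)$ in the composed relation, parameterizes (by the free coordinates $\rho_j$) the costates $\lambda_j$ compatible with both children. 3. Choose any $\lambda_0$ in the root feasible set, i.e. the set of $\lambda_0$ in $\mathcal D_0\circ\cdots\circ\mathcal D_N$. 4. Expansion: traverse the tree from root to leaves, computing each $\lambda_j$ from the stored maps with the free coordinates $\rho_j$ set to zero. 5. For each $i=0,\ldots,N-1$, solve $(\ast)$ for $(\mu_i,\eta_i)$ given $(\lambda_i,\lambda_{i+1})$; solve $(\ast\ast)$ for $\eta_N$ given $\lambda_N$; set $\alpha=-\lambda_0$. *)

theory Defs
  imports Complex_Main "HOL-Library.Tree" "Jordan_Normal_Form.Matrix_Kernel"
begin

(* Stage dimensions vary, so vectors and matrices are the explicitly dimensioned ones of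
   Jordan_Normal_Form; a constraint is absent when its matrix has no rows.
   Fields: cdim and edim count the rows of the mixed constraints (C, D, d) and of the state
   constraints (E, e). *)

record lqr =
  hor :: nat
  sdim :: "nat \<Rightarrow> nat"
  udim :: "nat \<Rightarrow> nat"
  cdim :: "nat \<Rightarrow> nat"
  edim :: "nat \<Rightarrow> nat"
  matQ :: "nat \<Rightarrow> real mat"
  matM :: "nat \<Rightarrow> real mat"
  matR :: "nat \<Rightarrow> real mat"
  vecq :: "nat \<Rightarrow> real vec"
  vecr :: "nat \<Rightarrow> real vec"
  matA :: "nat \<Rightarrow> real mat"
  matB :: "nat \<Rightarrow> real mat"
  vecc :: "nat \<Rightarrow> real vec"
  matC :: "nat \<Rightarrow> real mat"
  matD :: "nat \<Rightarrow> real mat"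
  vecd :: "nat \<Rightarrow> real vec"
  matE :: "nat \<Rightarrow> real mat"
  vece :: "nat \<Rightarrow> real vec"
  init :: "real vec"

definition lqr_problem :: "lqr \<Rightarrow> bool" where
  "lqr_problem P \<longleftrightarrow>
     1 \<le> hor P \<and> init P \<in> carrier_vec (sdim P 0) \<and>
     (\<forall>i\<le>hor P.
        matQ P i \<in> carrier_mat (sdim P i) (sdim P i) \<and> (matQ P i)\<^sup>T = matQ P i \<and>
        vecq P i \<in> carrier_vec (sdim P i) \<and>
        matE P i \<in> carrier_mat (edim P i) (sdim P i) \<and> vece P i \<in> carrier_vec (edim P i)) \<and>
     (\<forall>i<hor P.
        matM P i \<in> carrier_mat (sdim P i) (udim P i) \<and>
        matR P i \<in> carrier_mat (udim P i) (udim P i) \<and> (matR P i)\<^sup>T = matR P i \<and>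
        vecr P i \<in> carrier_vec (udim P i) \<and>
        matA P i \<in> carrier_mat (sdim P (Suc i)) (sdim P i) \<and>
        matB P i \<in> carrier_mat (sdim P (Suc i)) (udim P i) \<and>
        vecc P i \<in> carrier_vec (sdim P (Suc i)) \<and>
        matC P i \<in> carrier_mat (cdim P i) (sdim P i) \<and>
        matD P i \<in> carrier_mat (cdim P i) (udim P i) \<and>
        vecd P i \<in> carrier_vec (cdim P i))"

definition stage_cost :: "lqr \<Rightarrow> nat \<Rightarrow> real vec \<Rightarrow> real vec \<Rightarrow> real" where
  "stage_cost P i x u =
     1/2 * (x \<bullet> (matQ P i *\<^sub>v x)) + x \<bullet> (matM P i *\<^sub>v u) + 1/2 * (u \<bullet> (matR P i *\<^sub>v u))
     + vecq P i \<bullet> x + vecr P i \<bullet> u"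

definition lqr_cost :: "lqr \<Rightarrow> (nat \<Rightarrow> real vec) \<Rightarrow> (nat \<Rightarrow> real vec) \<Rightarrow> real" where
  "lqr_cost P x u =
     (\<Sum>i<hor P. stage_cost P i (x i) (u i))
     + 1/2 * (x (hor P) \<bullet> (matQ P (hor P) *\<^sub>v x (hor P))) + vecq P (hor P) \<bullet> x (hor P)"

definition state_constraint :: "lqr \<Rightarrow> nat \<Rightarrow> real vec \<Rightarrow> bool" where
  "state_constraint P i x \<longleftrightarrow> matE P i *\<^sub>v x + vece P i = 0\<^sub>v (edim P i)"

definition suffix_feasible :: "lqr \<Rightarrow> nat \<Rightarrow> (nat \<Rightarrow> real vec) \<Rightarrow> (nat \<Rightarrow> real vec) \<Rightarrow> bool" where
  "suffix_feasible P i x u \<longleftrightarrow>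
     (\<forall>k\<in>{i..hor P}. x k \<in> carrier_vec (sdim P k) \<and> state_constraint P k (x k)) \<and>
     (\<forall>k\<in>{i..<hor P}. u k \<in> carrier_vec (udim P k) \<and>
        x (Suc k) = matA P k *\<^sub>v x k + matB P k *\<^sub>v u k + vecc P k \<and>
        matC P k *\<^sub>v x k + matD P k *\<^sub>v u k + vecd P k = 0\<^sub>v (cdim P k))"

definition suffix_domain :: "lqr \<Rightarrow> nat \<Rightarrow> real vec set" where
  "suffix_domain P i = {\<xi>. \<exists>x u. x i = \<xi> \<and> suffix_feasible P i x u}"

definition lqr_feasible :: "lqr \<Rightarrow> (nat \<Rightarrow> real vec) \<Rightarrow> (nat \<Rightarrow> real vec) \<Rightarrow> bool" where
  "lqr_feasible P x u \<longleftrightarrow> x 0 = init P \<and> suffix_feasible P 0 x u"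

definition lqr_minimizer :: "lqr \<Rightarrow> (nat \<Rightarrow> real vec) \<Rightarrow> (nat \<Rightarrow> real vec) \<Rightarrow> bool" where
  "lqr_minimizer P x u \<longleftrightarrow>
     lqr_feasible P x u \<and> (\<forall>x' u'. lqr_feasible P x' u' \<longrightarrow> lqr_cost P x u \<le> lqr_cost P x' u')"

(* The choices H, h, t, T, S, Y, Z, y of the state and control parametrizations; the reduced
   dimensions are the numbers of columns of T and Z. *)

record param =
  matH :: "nat \<Rightarrow> real mat"
  vech :: "nat \<Rightarrow> real vec"
  vect :: "nat \<Rightarrow> real vec"
  matT :: "nat \<Rightarrow> real mat"
  matS :: "nat \<Rightarrow> real mat"
  matY :: "nat \<Rightarrow> real mat"
  matZ :: "nat \<Rightarrow> real mat"
  vecy :: "nat \<Rightarrow> real vec"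

abbreviation zdim :: "param \<Rightarrow> nat \<Rightarrow> nat" where "zdim K i \<equiv> dim_col (matT K i)"
abbreviation vdim :: "param \<Rightarrow> nat \<Rightarrow> nat" where "vdim K i \<equiv> dim_col (matZ K i)"

(* The library notion of basis concerns sets of vectors, hence the distinctness of the columns. *)

definition columns_basis_kernel :: "real mat \<Rightarrow> real mat \<Rightarrow> bool" where
  "columns_basis_kernel T H \<longleftrightarrow>
     dim_row T = dim_col H \<and> distinct (cols T) \<and>
     vectorspace.basis class_ring
       (module_vec TYPE(real) (dim_col H) \<lparr>carrier := mat_kernel H\<rparr>) (set (cols T))"

definition Gam :: "lqr \<Rightarrow> param \<Rightarrow> nat \<Rightarrow> real mat" where
  "Gam P K i = matD P i @\<^sub>r (matH K (Suc i) * matB P i)"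

definition Phi :: "lqr \<Rightarrow> param \<Rightarrow> nat \<Rightarrow> real mat" where
  "Phi P K i = (matC P i * matT K i) @\<^sub>r (matH K (Suc i) * matA P i * matT K i)"

definition gam :: "lqr \<Rightarrow> param \<Rightarrow> nat \<Rightarrow> real vec" where
  "gam P K i =
     (matC P i *\<^sub>v vect K i + vecd P i)
     @\<^sub>v (matH K (Suc i) *\<^sub>v (matA P i *\<^sub>v vect K i + vecc P i) + vech K (Suc i))"

definition valid_param :: "lqr \<Rightarrow> param \<Rightarrow> bool" where
  "valid_param P K \<longleftrightarrow>
     (\<forall>i\<le>hor P.
        matH K i \<in> carrier_mat (dim_row (matH K i)) (sdim P i) \<and>
        vech K i \<in> carrier_vec (dim_row (matH K i)) \<and>
        suffix_domain P i =
          {\<xi> \<in> carrier_vec (sdim P i). matH K i *\<^sub>v \<xi> + vech K i = 0\<^sub>v (dim_row (matH K i))} \<and>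
        vect K i \<in> carrier_vec (sdim P i) \<and>
        matH K i *\<^sub>v vect K i + vech K i = 0\<^sub>v (dim_row (matH K i)) \<and>
        columns_basis_kernel (matT K i) (matH K i) \<and>
        matS K i \<in> carrier_mat (zdim K i) (sdim P i) \<and>
        matS K i * matT K i = 1\<^sub>m (zdim K i)) \<and>
     (\<forall>i<hor P.
        matY K i \<in> carrier_mat (udim P i) (zdim K i) \<and>
        vecy K i \<in> carrier_vec (udim P i) \<and>
        columns_basis_kernel (matZ K i) (Gam P K i) \<and>
        (\<forall>z \<in> carrier_vec (zdim K i).
           {u \<in> carrier_vec (udim P i).
              Gam P K i *\<^sub>v u + Phi P K i *\<^sub>v z + gam P K i = 0\<^sub>v (dim_row (Gam P K i))} =
           {matY K i *\<^sub>v z + matZ K i *\<^sub>v v + vecy K i | v. v \<in> carrier_vec (vdim K i)}))"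

abbreviation Mz :: "lqr \<Rightarrow> param \<Rightarrow> nat \<Rightarrow> real mat" where
  "Mz P K i \<equiv> (matT K i)\<^sup>T * matM P i"
abbreviation rz :: "lqr \<Rightarrow> param \<Rightarrow> nat \<Rightarrow> real vec" where
  "rz P K i \<equiv> (matM P i)\<^sup>T *\<^sub>v vect K i + vecr P i"
abbreviation Qz :: "lqr \<Rightarrow> param \<Rightarrow> nat \<Rightarrow> real mat" where
  "Qz P K i \<equiv> (matT K i)\<^sup>T * matQ P i * matT K i"
abbreviation qz :: "lqr \<Rightarrow> param \<Rightarrow> nat \<Rightarrow> real vec" where
  "qz P K i \<equiv> (matT K i)\<^sup>T *\<^sub>v (matQ P i *\<^sub>v vect K i + vecq P i)"

definition reduced_lqr :: "lqr \<Rightarrow> param \<Rightarrow> lqr" where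
  "reduced_lqr P K = \<lparr>
     hor = hor P,
     sdim = (\<lambda>i. zdim K i),
     udim = (\<lambda>i. vdim K i),
     cdim = (\<lambda>i. 0),
     edim = (\<lambda>i. 0),
     matQ = (\<lambda>i. if i < hor P
               then Qz P K i + Mz P K i * matY K i + (matY K i)\<^sup>T * (Mz P K i)\<^sup>T
                    + (matY K i)\<^sup>T * matR P i * matY K i
               else Qz P K i),
     matM = (\<lambda>i. Mz P K i * matZ K i + (matY K i)\<^sup>T * matR P i * matZ K i),
     matR = (\<lambda>i. (matZ K i)\<^sup>T * matR P i * matZ K i),
     vecq = (\<lambda>i. if i < hor P
               then qz P K i + Mz P K i *\<^sub>v vecy K i
                    + (matY K i)\<^sup>T *\<^sub>v (matR P i *\<^sub>v vecy K i + rz P K i)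
               else qz P K i),
     vecr = (\<lambda>i. (matZ K i)\<^sup>T *\<^sub>v (matR P i *\<^sub>v vecy K i + rz P K i)),
     matA = (\<lambda>i. matS K (Suc i) * (matA P i * matT K i + matB P i * matY K i)),
     matB = (\<lambda>i. matS K (Suc i) * matB P i * matZ K i),
     vecc = (\<lambda>i. matS K (Suc i) *\<^sub>v
               (matA P i *\<^sub>v vect K i + matB P i *\<^sub>v vecy K i + vecc P i - vect K (Suc i))),
     matC = (\<lambda>i. 0\<^sub>m 0 (zdim K i)),
     matD = (\<lambda>i. 0\<^sub>m 0 (vdim K i)),
     vecd = (\<lambda>i. 0\<^sub>v 0),
     matE = (\<lambda>i. 0\<^sub>m 0 (zdim K i)),
     vece = (\<lambda>i. 0\<^sub>v 0),
     init = matS K 0 *\<^sub>v (init P - vect K 0)\<rparr>"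

definition recover_x :: "param \<Rightarrow> (nat \<Rightarrow> real vec) \<Rightarrow> nat \<Rightarrow> real vec" where
  "recover_x K z i = matT K i *\<^sub>v z i + vect K i"

definition recover_u :: "param \<Rightarrow> (nat \<Rightarrow> real vec) \<Rightarrow> (nat \<Rightarrow> real vec) \<Rightarrow> nat \<Rightarrow> real vec" where
  "recover_u K z v i = matY K i *\<^sub>v z i + matZ K i *\<^sub>v v i + vecy K i"

definition stationary ::
  "lqr \<Rightarrow> (nat \<Rightarrow> real vec) \<Rightarrow> (nat \<Rightarrow> real vec) \<Rightarrow> nat \<Rightarrow>
   real vec \<Rightarrow> real vec \<Rightarrow> real vec \<Rightarrow> real vec \<Rightarrow> bool" where
  "stationary P x u i l l' \<mu> \<eta> \<longleftrightarrow>
     \<mu> \<in> carrier_vec (cdim P i) \<and> \<eta> \<in> carrier_vec (edim P i) \<and>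
     (matQ P i *\<^sub>v x i + matM P i *\<^sub>v u i + vecq P i) - l + (matA P i)\<^sup>T *\<^sub>v l'
       + (matC P i)\<^sup>T *\<^sub>v \<mu> + (matE P i)\<^sup>T *\<^sub>v \<eta> = 0\<^sub>v (sdim P i) \<and>
     ((matM P i)\<^sup>T *\<^sub>v x i + matR P i *\<^sub>v u i + vecr P i) + (matB P i)\<^sup>T *\<^sub>v l'
       + (matD P i)\<^sup>T *\<^sub>v \<mu> = 0\<^sub>v (udim P i)"

definition terminal_stationary :: "lqr \<Rightarrow> (nat \<Rightarrow> real vec) \<Rightarrow> real vec \<Rightarrow> real vec \<Rightarrow> bool" where
  "terminal_stationary P x l \<eta> \<longleftrightarrow>
     \<eta> \<in> carrier_vec (edim P (hor P)) \<and>
     (matQ P (hor P) *\<^sub>v x (hor P) + vecq P (hor P)) - l + (matE P (hor P))\<^sup>T *\<^sub>v \<eta>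
       = 0\<^sub>v (sdim P (hor P))"

definition solves_stationarity ::
  "lqr \<Rightarrow> (nat \<Rightarrow> real vec) \<Rightarrow> (nat \<Rightarrow> real vec) \<Rightarrow>
   (nat \<Rightarrow> real vec) \<Rightarrow> (nat \<Rightarrow> real vec) \<Rightarrow> (nat \<Rightarrow> real vec) \<Rightarrow> bool" where
  "solves_stationarity P x u lam \<mu> \<eta> \<longleftrightarrow>
     (\<forall>i<hor P. stationary P x u i (lam i) (lam (Suc i)) (\<mu> i) (\<eta> i)) \<and>
     terminal_stationary P x (lam (hor P)) (\<eta> (hor P))"

(* The multipliers are lam 1, ..., lam N, mu, eta and alpha: the value of lam at 0 is irrelevant,
   the formal initial costate being - alpha. *)

definition kkt ::
  "lqr \<Rightarrow> (nat \<Rightarrow> real vec) \<Rightarrow> (nat \<Rightarrow> real vec) \<Rightarrow>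
   (nat \<Rightarrow> real vec) \<Rightarrow> (nat \<Rightarrow> real vec) \<Rightarrow> (nat \<Rightarrow> real vec) \<Rightarrow> real vec \<Rightarrow> bool" where
  "kkt P x u lam \<mu> \<eta> \<alpha> \<longleftrightarrow>
     lqr_feasible P x u \<and>
     \<alpha> \<in> carrier_vec (sdim P 0) \<and> (\<forall>i\<in>{1..hor P}. lam i \<in> carrier_vec (sdim P i)) \<and>
     solves_stationarity P x u (lam(0 := - \<alpha>)) \<mu> \<eta>"

(* The costate endpoint with index N + 1 is the zero-dimensional dummy endpoint of the last
   relation. *)

definition costate_dim :: "lqr \<Rightarrow> nat \<Rightarrow> nat" where
  "costate_dim P i = (if i \<le> hor P then sdim P i else 0)"

definition leaf_rel ::
  "lqr \<Rightarrow> (nat \<Rightarrow> real vec) \<Rightarrow> (nat \<Rightarrow> real vec) \<Rightarrow> nat \<Rightarrow> real vec rel" where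
  "leaf_rel P x u i =
     {(l, l') \<in> carrier_vec (costate_dim P i) \<times> carrier_vec (costate_dim P (Suc i)).
        if i < hor P then \<exists>\<mu> \<eta>. stationary P x u i l l' \<mu> \<eta>
        else \<exists>\<eta>. terminal_stationary P x l \<eta>}"

(* A composition tree over the leaves a, a + 1, ..., b - 1 is a search tree whose inner nodes are
   labelled in order by the eliminated costates a + 1, ..., b - 1: a node labelled j on the
   interval from a to b composes the relations on a to j and on j to b. *)

fun tree_rel :: "(nat \<Rightarrow> real vec rel) \<Rightarrow> nat \<Rightarrow> nat tree \<Rightarrow> real vec rel" where
  "tree_rel \<D> a \<langle>\<rangle> = \<D> a"
| "tree_rel \<D> a \<langle>l, j, r\<rangle> = tree_rel \<D> a l O tree_rel \<D> j r"

fun solution_maps ::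
  "(nat \<Rightarrow> nat) \<Rightarrow> (nat \<Rightarrow> real vec rel) \<Rightarrow>
   (nat \<Rightarrow> real mat) \<Rightarrow> (nat \<Rightarrow> real vec) \<Rightarrow> (nat \<Rightarrow> real mat) \<Rightarrow>
   nat \<Rightarrow> nat \<Rightarrow> nat tree \<Rightarrow> bool" where
  "solution_maps n \<D> \<P> \<p> \<Z> a b \<langle>\<rangle> = True"
| "solution_maps n \<D> \<P> \<p> \<Z> a b \<langle>l, j, r\<rangle> =
     (\<P> j \<in> carrier_mat (n j) (n a + n b) \<and> \<p> j \<in> carrier_vec (n j) \<and>
      \<Z> j \<in> carrier_mat (n j) (dim_col (\<Z> j)) \<and>
      (\<forall>(la, lb) \<in> tree_rel \<D> a \<langle>l, j, r\<rangle>.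
         {\<P> j *\<^sub>v (la @\<^sub>v lb) + \<p> j + \<Z> j *\<^sub>v \<rho> | \<rho>. \<rho> \<in> carrier_vec (dim_col (\<Z> j))} =
         {lj. (la, lj) \<in> tree_rel \<D> a l \<and> (lj, lb) \<in> tree_rel \<D> j r}) \<and>
      solution_maps n \<D> \<P> \<p> \<Z> a j l \<and> solution_maps n \<D> \<P> \<p> \<Z> j b r)"

fun expand ::
  "(nat \<Rightarrow> real mat) \<Rightarrow> (nat \<Rightarrow> real vec) \<Rightarrow> (nat \<Rightarrow> real mat) \<Rightarrow>
   nat \<Rightarrow> nat \<Rightarrow> nat tree \<Rightarrow> (nat \<Rightarrow> real vec) \<Rightarrow> nat \<Rightarrow> real vec" where
  "expand \<P> \<p> \<Z> a b \<langle>\<rangle> lam = lam"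
| "expand \<P> \<p> \<Z> a b \<langle>l, j, r\<rangle> lam =
     (let lam' = lam(j := \<P> j *\<^sub>v (lam a @\<^sub>v lam b) + \<p> j + \<Z> j *\<^sub>v 0\<^sub>v (dim_col (\<Z> j)))
      in expand \<P> \<p> \<Z> j b r (expand \<P> \<p> \<Z> a j l lam'))"

definition contraction ::
  "lqr \<Rightarrow> (nat \<Rightarrow> real vec) \<Rightarrow> (nat \<Rightarrow> real vec) \<Rightarrow> nat tree \<Rightarrow>
   (nat \<Rightarrow> real mat) \<Rightarrow> (nat \<Rightarrow> real vec) \<Rightarrow> (nat \<Rightarrow> real mat) \<Rightarrow> bool" where
  "contraction P x u \<tau> \<P> \<p> \<Z> \<longleftrightarrow>
     solution_maps (costate_dim P) (leaf_rel P x u) \<P> \<p> \<Z> 0 (Suc (hor P)) \<tau>"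

definition root_feasible ::
  "lqr \<Rightarrow> (nat \<Rightarrow> real vec) \<Rightarrow> (nat \<Rightarrow> real vec) \<Rightarrow> nat tree \<Rightarrow> real vec set" where
  "root_feasible P x u \<tau> = Domain (tree_rel (leaf_rel P x u) 0 \<tau>)"

(* The costates computed from lam0; all other costates are initialized with the value of the
   dummy endpoint. *)

definition expansion ::
  "lqr \<Rightarrow> nat tree \<Rightarrow> (nat \<Rightarrow> real mat) \<Rightarrow> (nat \<Rightarrow> real vec) \<Rightarrow> (nat \<Rightarrow> real mat) \<Rightarrow>
   real vec \<Rightarrow> nat \<Rightarrow> real vec" where
  "expansion P \<tau> \<P> \<p> \<Z> lam0 = expand \<P> \<p> \<Z> 0 (Suc (hor P)) \<tau> ((\<lambda>_. 0\<^sub>v 0)(0 := lam0))"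

(* Balance only bounds the depth of the tree. Trees of every shape are admitted, so that every
   notion of a balanced tree is covered. *)

definition stage_tree :: "nat \<Rightarrow> nat tree \<Rightarrow> bool" where
  "stage_tree N \<tau> \<longleftrightarrow> inorder \<tau> = [1..<Suc N]"

end

theory Submission
  imports Defs
begin

text \<open>
  The reduced problem is unconstrained, so a minimizer comes with adjoint vectors \<open>\<zeta> i\<close> satisfying
  the adjoint recursion and control stationarity. Multipliers of the original problem are built
  forward in time, with the invariant that \<open>(matT K i)\<^sup>T\<close> maps \<open>lam i\<close> to \<open>\<zeta> i\<close>. By the Fredholm
  alternative, the stage equations for \<open>lam (Suc i)\<close> and the stage multipliers are solvable as soon
  as their right-hand side annihilates all directions \<open>(\<xi>, \<omega>, w)\<close> with \<open>A \<xi> + B \<omega> = T w\<close>,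
  \<open>C \<xi> + D \<omega> = 0\<close> and \<open>E \<xi> = 0\<close>. Such a direction stays inside the suffix domains and is therefore
  the image of a direction of the reduced problem, where the adjoint equations apply. Hence optimality
  in the original problem is never needed.

  The tree procedure only has to find some chain of costates: the leaf relations are affine, so are
  their compositions, and elimination of the shared costate in a composition of affine relations
  is an affine map modulo a linear one.
\<close>

section \<open>Linear maps between coordinate vectors\<close>

text \<open>Without rank assumptions the multipliers are not unique, and a costate that solves one
  stage may have no continuation at the next. The invariant prevents this: the transpose of
  \<open>matT K i\<close> forgets exactly the part of \<open>lam i\<close> orthogonal to the
  directions of the suffix domain at \<open>i\<close>, and what it keeps has to be the costate of
  the reduced problem. At time 0 it can be met because \<open>matT K 0\<close> has a left inverse.
  At the horizon the directions form the kernel of \<open>matE P (hor P)\<close>, so there the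
  invariant says that the terminal equation is solvable. The suffix domains are given only as
  solution sets of the chosen \<open>matH\<close> and \<open>vech\<close>. A direction is therefore
  tested by adding it to a feasible point and comparing two points of the domain. No definiteness is
  assumed, so the minimizer enters only through vanishing directional derivatives. Any root point
  may start the expansion: a pair in a composed relation is by definition the two ends of a chain,
  and zero free coordinates pick one admissible inner costate.\<close>

lemma mult_mat_vec_add: "dim_vec x = dim_col A \<Longrightarrow> dim_vec y = dim_col A \<Longrightarrow>
    (A :: real mat) *\<^sub>v (x + y) = A *\<^sub>v x + A *\<^sub>v y"
  by (rule mult_add_distrib_mat_vec[of A "dim_row A" "dim_col A"]) (rule carrier_matI carrier_vecI, simp, simp?)+

lemma mult_mat_vec_minus: "dim_vec x = dim_col A \<Longrightarrow> dim_vec y = dim_col A \<Longrightarrow>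
    (A :: real mat) *\<^sub>v (x - y) = A *\<^sub>v x - A *\<^sub>v y"
  by (rule mult_minus_distrib_mat_vec[of A "dim_row A" "dim_col A"]) (rule carrier_matI carrier_vecI, simp, simp?)+

lemma mult_mat_vec_smult: "dim_vec x = dim_col A \<Longrightarrow>
    (A :: real mat) *\<^sub>v (c \<cdot>\<^sub>v x) = c \<cdot>\<^sub>v (A *\<^sub>v x)"
  by (rule mult_mat_vec[of A "dim_row A" "dim_col A"]) (rule carrier_matI carrier_vecI, simp, simp?)+

lemma add_mat_mult_vec: "dim_row A = dim_row B \<Longrightarrow> dim_col A = dim_col B \<Longrightarrow> dim_vec x = dim_col B \<Longrightarrow>
    ((A :: real mat) + B) *\<^sub>v x = A *\<^sub>v x + B *\<^sub>v x"
  by (rule add_mult_distrib_mat_vec[of A "dim_row A" "dim_col A"]) (rule carrier_matI carrier_vecI, simp, simp?)+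

lemma minus_mat_mult_vec: "dim_row A = dim_row B \<Longrightarrow> dim_col A = dim_col B \<Longrightarrow> dim_vec x = dim_col B \<Longrightarrow>
    ((A :: real mat) - B) *\<^sub>v x = A *\<^sub>v x - B *\<^sub>v x"
  by (rule minus_mult_distrib_mat_vec[of A "dim_row A" "dim_col A"]) (rule carrier_matI carrier_vecI, simp, simp?)+

lemma mult_mat_mult_vec: "dim_col A = dim_row B \<Longrightarrow> dim_vec x = dim_col B \<Longrightarrow>
    ((A :: real mat) * B) *\<^sub>v x = A *\<^sub>v (B *\<^sub>v x)"
  by (rule assoc_mult_mat_vec[of A "dim_row A" "dim_col A" B "dim_col B"]) (rule carrier_matI carrier_vecI, simp, simp?)+

text \<open>The carrier premises of the library laws contain dimensions that do not occur in the
  conclusion, so the simplifier would have to guess them. Equations between dimensions avoid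
  this.\<close>

lemmas mult_mat_vec_linear = mult_mat_vec_add mult_mat_vec_minus mult_mat_vec_smult
  add_mat_mult_vec minus_mat_mult_vec mult_mat_mult_vec

lemma scalar_prod_linear:
  fixes x y z :: "real vec"
  shows "dim_vec x = dim_vec z \<Longrightarrow> dim_vec y = dim_vec z \<Longrightarrow> (x + y) \<bullet> z = x \<bullet> z + y \<bullet> z"
    and "dim_vec y = dim_vec x \<Longrightarrow> dim_vec z = dim_vec x \<Longrightarrow> x \<bullet> (y + z) = x \<bullet> y + x \<bullet> z"
    and "dim_vec x = dim_vec z \<Longrightarrow> dim_vec y = dim_vec z \<Longrightarrow> (x - y) \<bullet> z = x \<bullet> z - y \<bullet> z"
    and "dim_vec y = dim_vec x \<Longrightarrow> dim_vec z = dim_vec x \<Longrightarrow> x \<bullet> (y - z) = x \<bullet> y - x \<bullet> z"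
    and "dim_vec x = dim_vec z \<Longrightarrow> (c \<cdot>\<^sub>v x) \<bullet> z = c * (x \<bullet> z)"
    and "dim_vec z = dim_vec x \<Longrightarrow> x \<bullet> (c \<cdot>\<^sub>v z) = c * (x \<bullet> z)"
  by (simp_all add: scalar_prod_def algebra_simps sum.distrib sum_subtractf sum_distrib_left)

lemma scalar_prod_commute: "dim_vec x = dim_vec y \<Longrightarrow> (x :: real vec) \<bullet> y = y \<bullet> x"
  by (simp add: scalar_prod_def mult.commute)

lemma scalar_prod_transpose:
  assumes "dim_vec x = dim_row A" "dim_vec y = dim_col A"
  shows "((A :: real mat)\<^sup>T *\<^sub>v x) \<bullet> y = x \<bullet> (A *\<^sub>v y)"
  using assms by (intro transpose_vec_mult_scalar[of A "dim_row A" "dim_col A"]) (rule carrier_matI carrier_vecI, simp, simp?)+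

section \<open>Generalized inverses and subspaces\<close>

text \<open>Induction on the number of columns. The product \<open>T\<close> of \<open>A\<close> and
  \<open>G\<close> fixes the columns treated so far. If \<open>T\<close> also fixes the new column,
  \<open>G\<close> gets a zero row. Otherwise a rank-one term built from the residual
  \<open>c\<close> of that column repairs the product.\<close>

lemma generalized_inverse_fun:
  fixes A :: "nat \<Rightarrow> nat \<Rightarrow> real"
  shows "\<exists>G. \<forall>i<m. \<forall>j<n. (\<Sum>l<m. (\<Sum>k<n. A i k * G k l) * A l j) = A i j"
proof (induction n)
  case 0
  show ?case by simp
next
  case (Suc n)
  then obtain G where G: "\<And>i j. i < m \<Longrightarrow> j < n \<Longrightarrow> (\<Sum>l<m. (\<Sum>k<n. A i k * G k l) * A l j) = A i j"
    by blast
  define T where "T i l = (\<Sum>k<n. A i k * G k l)" for i l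
  define c where "c i = A i n - (\<Sum>p<m. T i p * A p n)" for i
  have TA: "(\<Sum>l<m. T i l * A l j) = A i j" if "i < m" "j < n" for i j
    using G[OF that] by (simp add: T_def)
  show ?case
  proof (cases "\<forall>i<m. c i = 0")
    case True
    define G' where "G' k l = (if k < n then G k l else 0)" for k l
    have "(\<Sum>l<m. (\<Sum>k<Suc n. A i k * G' k l) * A l j) = A i j" if "i < m" "j < Suc n" for i j
    proof -
      have "(\<Sum>k<Suc n. A i k * G' k l) = T i l" for l by (simp add: G'_def T_def)
      moreover have "(\<Sum>l<m. T i l * A l j) = A i j"
      proof (cases "j = n")
        case True
        have "c i = 0" using \<open>\<forall>i<m. c i = 0\<close> that by blast
        then show ?thesis unfolding True c_def by linarith
      qed (use TA that in simp)
      ultimately show ?thesis by simp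
    qed
    then show ?thesis by blast
  next
    case False
    define s where "s = (\<Sum>i<m. c i * c i)"
    from False obtain i0 where "i0 < m" "c i0 \<noteq> 0" by blast
    then have "s > 0" unfolding s_def by (intro sum_pos2[of _ i0]) (auto simp: zero_less_mult_iff)
    \<comment> \<open>The functional \<phi> kills the first n columns and takes the value 1 on column n.\<close>
    define \<phi> where "\<phi> l = (c l - (\<Sum>p<m. c p * T p l)) / s" for l
    have phi: "(\<Sum>l<m. \<phi> l * A l j) = (\<Sum>p<m. c p * (A p j - (\<Sum>l<m. T p l * A l j))) / s" for j
    proof -
      have "(\<Sum>l<m. (\<Sum>p<m. c p * T p l) * A l j) = (\<Sum>p<m. c p * (\<Sum>l<m. T p l * A l j))"
        unfolding sum_distrib_left sum_distrib_right
        by (subst sum.swap) (simp add: mult.assoc)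
      then show ?thesis
        by (simp add: \<phi>_def sum_divide_distrib[symmetric] algebra_simps sum_subtractf)
    qed
    have phi0: "(\<Sum>l<m. \<phi> l * A l j) = 0" if "j < n" for j
      unfolding phi using TA that by simp
    have phi1: "(\<Sum>l<m. \<phi> l * A l n) = 1"
      unfolding phi c_def[symmetric] using \<open>s > 0\<close> by (simp add: s_def)
    \<comment> \<open>Chosen so that the new product is \<open>T\<close> plus the outer product of
      \<open>c\<close> and \<open>\<phi>\<close>: old columns stay fixed because
      \<open>\<phi>\<close> kills them, and the new column gains its missing residual
      \<open>c\<close>.\<close>
    define G' where "G' k l = (if k < n then G k l - (\<Sum>p<m. G k p * A p n) * \<phi> l else \<phi> l)" for k l
    have T': "(\<Sum>k<Suc n. A i k * G' k l) = T i l + c i * \<phi> l" for i l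
    proof -
      have "(\<Sum>k<n. A i k * ((\<Sum>p<m. G k p * A p n) * \<phi> l)) = (\<Sum>p<m. T i p * A p n) * \<phi> l"
        unfolding T_def sum_distrib_left sum_distrib_right
        by (subst sum.swap) (simp add: mult.assoc)
      then show ?thesis
        by (simp add: G'_def c_def algebra_simps sum_subtractf) (simp add: T_def)
    qed
    have "(\<Sum>l<m. (\<Sum>k<Suc n. A i k * G' k l) * A l j) = A i j" if "i < m" "j < Suc n" for i j
    proof -
      have "(\<Sum>l<m. (\<Sum>k<Suc n. A i k * G' k l) * A l j)
          = (\<Sum>l<m. T i l * A l j) + c i * (\<Sum>l<m. \<phi> l * A l j)"
        unfolding T' by (simp add: distrib_right sum.distrib sum_distrib_left mult.assoc)
      also have "\<dots> = A i j"
      proof (cases "j = n")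
        case True
        then show ?thesis using phi1 by (simp add: c_def)
      next
        case False
        then show ?thesis using phi0[of j] TA[of i j] that by simp
      qed
      finally show ?thesis .
    qed
    then show ?thesis by blast
  qed
qed

text \<open>The product \<open>K * G\<close> fixes the range of \<open>K\<close>. So
  \<open>G *\<^sub>v b\<close> solves the system with matrix \<open>K\<close> and right-hand side
  \<open>b\<close> whenever that system is solvable, whatever the rank.\<close>

lemma generalized_inverse:
  fixes K :: "real mat"
  assumes K: "K \<in> carrier_mat m n"
  obtains G where "G \<in> carrier_mat n m" "K * G * K = K"
proof -
  obtain G where G: "\<And>i j. i < m \<Longrightarrow> j < n \<Longrightarrow>
      (\<Sum>l<m. (\<Sum>k<n. K $$ (i, k) * G k l) * K $$ (l, j)) = K $$ (i, j)"
    using generalized_inverse_fun[of m n "\<lambda>i j. K $$ (i, j)"] by blast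
  have "K * mat n m (\<lambda>(k, l). G k l) * K = K"
    using K by (intro eq_matI) (auto simp: scalar_prod_def G lessThan_atLeast0[symmetric])
  then show ?thesis using that[of "mat n m (\<lambda>(k, l). G k l)"] by auto
qed

section \<open>Subspaces as column ranges, and the Fredholm alternative\<close>

definition vec_subspace :: "nat \<Rightarrow> real vec set \<Rightarrow> bool" where
  "vec_subspace n V \<longleftrightarrow>
     V \<subseteq> carrier_vec n \<and> 0\<^sub>v n \<in> V \<and> (\<forall>v\<in>V. \<forall>w\<in>V. \<forall>c. v + c \<cdot>\<^sub>v w \<in> V)"

text \<open>Echelon argument on the layers of vectors whose entries from index m on vanish. Raising
  m by one costs at most one column, because a single member \<open>f\<close> with nonzero entry at
  m clears that entry in all others.\<close>

lemma vec_subspace_range: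
  assumes V: "vec_subspace n V"
  obtains k B where "B \<in> carrier_mat n k" "V = {B *\<^sub>v \<nu> | \<nu>. \<nu> \<in> carrier_vec k}"
proof -
  have VD: "V \<subseteq> carrier_vec n" "0\<^sub>v n \<in> V" "\<And>v w c. v \<in> V \<Longrightarrow> w \<in> V \<Longrightarrow> v + c \<cdot>\<^sub>v w \<in> V"
    using V by (auto simp: vec_subspace_def)
  have "\<exists>B k. B \<in> carrier_mat n k \<and>
      {v \<in> V. \<forall>i. m \<le> i \<and> i < n \<longrightarrow> v $ i = 0} = {B *\<^sub>v \<nu> | \<nu>. \<nu> \<in> carrier_vec k}"
    if "m \<le> n" for m
    using that
  proof (induction m)
    case 0
    have 1: "{v \<in> V. \<forall>i. 0 \<le> i \<and> i < n \<longrightarrow> v $ i = 0} = {0\<^sub>v n}"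
    proof (intro equalityI subsetI)
      fix v assume v: "v \<in> {v \<in> V. \<forall>i. 0 \<le> i \<and> i < n \<longrightarrow> v $ i = 0}"
      then have "v \<in> carrier_vec n" using VD(1) by blast
      then have "v = 0\<^sub>v n" using v by (intro eq_vecI) auto
      then show "v \<in> {0\<^sub>v n}" by simp
    qed (use VD(2) in simp)
    have 2: "0\<^sub>m n 0 *\<^sub>v \<nu> = 0\<^sub>v n" if "\<nu> \<in> carrier_vec 0" for \<nu> :: "real vec"
      using that by (intro eq_vecI) (auto simp: scalar_prod_def)
    have "{0\<^sub>m n 0 *\<^sub>v \<nu> | \<nu>. \<nu> \<in> carrier_vec 0} = {0\<^sub>v n :: real vec}"
    proof (intro equalityI subsetI)
      fix v assume "v \<in> {0\<^sub>v n :: real vec}"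
      then show "v \<in> {0\<^sub>m n 0 *\<^sub>v \<nu> | \<nu>. \<nu> \<in> carrier_vec 0}"
        using 2[of "0\<^sub>v 0"] by (intro CollectI exI[of _ "0\<^sub>v 0"]) simp
    next
      fix v :: "real vec" assume "v \<in> {0\<^sub>m n 0 *\<^sub>v \<nu> | \<nu>. \<nu> \<in> carrier_vec 0}"
      then obtain \<nu> where "\<nu> \<in> carrier_vec 0" "v = 0\<^sub>m n 0 *\<^sub>v \<nu>" by blast
      then show "v \<in> {0\<^sub>v n}" by (simp only: 2 singleton_iff)
    qed
    then show ?case using 1 by (intro exI[of _ "0\<^sub>m n 0"] exI[of _ 0] conjI) simp_all
  next
    case (Suc m)
    then obtain B k where B: "B \<in> carrier_mat n k"
      and eq: "{v \<in> V. \<forall>i. m \<le> i \<and> i < n \<longrightarrow> v $ i = 0} = {B *\<^sub>v \<nu> | \<nu>. \<nu> \<in> carrier_vec k}"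
      by auto
    have split: "(\<forall>i. m \<le> i \<and> i < n \<longrightarrow> v $ i = 0) \<longleftrightarrow>
        v $ m = 0 \<and> (\<forall>i. Suc m \<le> i \<and> i < n \<longrightarrow> v $ i = 0)" for v :: "real vec"
      using Suc.prems by (metis Suc_le_eq le_eq_less_or_eq)
    let ?W = "{v \<in> V. \<forall>i. Suc m \<le> i \<and> i < n \<longrightarrow> v $ i = 0}"
    show ?case
    proof (cases "\<forall>v\<in>?W. v $ m = 0")
      case True
      then have "?W = {v \<in> V. \<forall>i. m \<le> i \<and> i < n \<longrightarrow> v $ i = 0}"
        unfolding split by blast
      then show ?thesis using B eq by auto
    next
      case False
      then obtain f where f: "f \<in> ?W" "f $ m \<noteq> 0" by blast
      have fc: "f \<in> carrier_vec n" using f VD by auto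
      define B' where "B' = mat n (Suc k) (\<lambda>(i, j). if j < k then B $$ (i, j) else f $ i)"
      have B': "B' *\<^sub>v \<nu> = B *\<^sub>v vec k (($) \<nu>) + \<nu> $ k \<cdot>\<^sub>v f" if "\<nu> \<in> carrier_vec (Suc k)" for \<nu>
        using that B fc by (intro eq_vecI) (auto simp: B'_def scalar_prod_def)
      have "?W = {B' *\<^sub>v \<nu> | \<nu>. \<nu> \<in> carrier_vec (Suc k)}"
      proof (intro equalityI subsetI)
        fix v assume v: "v \<in> ?W"
        have vc: "v \<in> carrier_vec n" using v VD by auto
        \<comment> \<open>Subtracting this multiple of \<open>f\<close> clears the entry at
          \<open>m\<close> and moves \<open>v\<close> to the previous layer.\<close>
        define c where "c = v $ m / f $ m"
        have "v + (- c) \<cdot>\<^sub>v f \<in> {v \<in> V. \<forall>i. m \<le> i \<and> i < n \<longrightarrow> v $ i = 0}"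
          unfolding split using v f fc vc VD(3) Suc.prems by (auto simp: c_def)
        then obtain \<nu> where \<nu>: "\<nu> \<in> carrier_vec k" "v + (- c) \<cdot>\<^sub>v f = B *\<^sub>v \<nu>" using eq by auto
        define \<nu>' where "\<nu>' = vec (Suc k) (\<lambda>i. if i < k then \<nu> $ i else c)"
        have "vec k (($) \<nu>') = \<nu>" using \<nu> by (intro eq_vecI) (auto simp: \<nu>'_def)
        moreover have "\<nu>' $ k = c" by (simp add: \<nu>'_def)
        ultimately have "B' *\<^sub>v \<nu>' = (v + (- c) \<cdot>\<^sub>v f) + c \<cdot>\<^sub>v f"
          using B'[of \<nu>'] by (simp add: \<nu>(2)) (simp add: \<nu>'_def)
        also have "\<dots> = v" using vc fc by (intro eq_vecI) auto
        finally have "v = B' *\<^sub>v \<nu>'" ..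
        moreover have "\<nu>' \<in> carrier_vec (Suc k)" by (simp add: \<nu>'_def)
        ultimately show "v \<in> {B' *\<^sub>v \<nu> | \<nu>. \<nu> \<in> carrier_vec (Suc k)}" by blast
      next
        fix v assume "v \<in> {B' *\<^sub>v \<nu> | \<nu>. \<nu> \<in> carrier_vec (Suc k)}"
        then obtain \<nu> where \<nu>: "\<nu> \<in> carrier_vec (Suc k)" "v = B *\<^sub>v vec k (($) \<nu>) + \<nu> $ k \<cdot>\<^sub>v f"
          using B' by auto
        have "B *\<^sub>v vec k (($) \<nu>) \<in> {v \<in> V. \<forall>i. m \<le> i \<and> i < n \<longrightarrow> v $ i = 0}"
          unfolding eq by auto
        then show "v \<in> ?W" unfolding \<nu>(2) using f fc B VD(3) by auto
      qed
      moreover have "B' \<in> carrier_mat n (Suc k)" by (simp add: B'_def)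
      ultimately show ?thesis by blast
    qed
  qed
  \<comment> \<open>At \<open>m = n\<close> the condition on the entries is vacuous, so the layer is
    all of \<open>V\<close>.\<close>
  from this[of n] obtain B k where B: "B \<in> carrier_mat n k"
      and eq: "{v \<in> V. \<forall>i. n \<le> i \<and> i < n \<longrightarrow> v $ i = 0} = {B *\<^sub>v \<nu> | \<nu>. \<nu> \<in> carrier_vec k}"
    by auto
  from eq have "V = {B *\<^sub>v \<nu> | \<nu>. \<nu> \<in> carrier_vec k}" by auto
  with B show ?thesis by (rule that)
qed

text \<open>
  Carrier membership is normalized to equations between dimensions. The default simp rules go the
  other way, and both directions together make the simplifier loop.
\<close>

declare carrier_vecD [simp del] carrier_matD [simp del]
declare carrier_dim_vec [simp]
lemma carrier_mat_iff [simp]: "A \<in> carrier_mat m n \<longleftrightarrow> dim_row A = m \<and> dim_col A = n"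
  by (simp add: carrier_mat_def)

lemma eq_vec_if_minus_eq_0:
  fixes a b :: "real vec"
  assumes "a - b = 0\<^sub>v n" "dim_vec a = n" "dim_vec b = n"
  shows "a = b"
proof (rule eq_vecI)
  fix i assume "i < dim_vec b"
  then show "a $ i = b $ i"
    using assms(2,3) arg_cong[OF assms(1), of "\<lambda>v. v $ i"] by simp
qed (simp add: assms)

text \<open>With \<open>V\<close> the range of \<open>B\<close>, the vector \<open>b\<close> lies in
  \<open>V\<close> once its residual \<open>r\<close> vanishes. A test vector \<open>y\<close>
  orthogonal to \<open>V\<close> is built for which \<open>b \<bullet> y\<close> equals the squared
  norm of \<open>r\<close>.\<close>

lemma vec_subspace_double_perp:
  assumes V: "vec_subspace n V" and b: "b \<in> carrier_vec n"
    and perp: "\<And>y. y \<in> carrier_vec n \<Longrightarrow> (\<And>v. v \<in> V \<Longrightarrow> v \<bullet> y = 0) \<Longrightarrow> b \<bullet> y = 0"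
  shows "b \<in> V"
proof -
  obtain k B where B: "B \<in> carrier_mat n k"
    and VB: "V = {B *\<^sub>v \<nu> | \<nu>. \<nu> \<in> carrier_vec k}"
    by (rule vec_subspace_range[OF V])
  obtain G where G: "G \<in> carrier_mat k n" and BGB: "B * G * B = B"
    using generalized_inverse[OF B] .
  have dims [simp]: "dim_row B = n" "dim_col B = k" "dim_row G = k" "dim_col G = n" "dim_vec b = n"
    using B G b by simp_all
  define r where "r = b - B *\<^sub>v (G *\<^sub>v b)"
  have [simp]: "dim_vec r = n" by (simp add: r_def)
  \<comment> \<open>The residual r, transported by the transpose of I - B G, which kills the range of B.\<close>
  define y where "y = r - (B * G)\<^sup>T *\<^sub>v r"
  have [simp]: "dim_vec y = n" by (simp add: y_def)
  have vy: "v \<bullet> y = (v - B *\<^sub>v (G *\<^sub>v v)) \<bullet> r" if [simp]: "dim_vec v = n" for v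
  proof -
    have "v \<bullet> ((B * G)\<^sup>T *\<^sub>v r) = ((B * G)\<^sup>T *\<^sub>v r) \<bullet> v"
      by (rule scalar_prod_commute) simp
    also have "\<dots> = r \<bullet> ((B * G) *\<^sub>v v)" by (rule scalar_prod_transpose) simp_all
    also have "\<dots> = ((B * G) *\<^sub>v v) \<bullet> r" by (rule scalar_prod_commute) simp
    also have "(B * G) *\<^sub>v v = B *\<^sub>v (G *\<^sub>v v)" by (simp add: mult_mat_mult_vec)
    finally show ?thesis by (simp add: y_def scalar_prod_linear)
  qed
  have "v \<bullet> y = 0" if v: "v \<in> V" for v
  proof -
    obtain \<nu> where \<nu>c: "\<nu> \<in> carrier_vec k" and \<nu>: "v = B *\<^sub>v \<nu>" using v VB by blast
    have [simp]: "dim_vec \<nu> = k" using \<nu>c by simp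
    have "B *\<^sub>v (G *\<^sub>v v) = (B * G * B) *\<^sub>v \<nu>" by (simp add: \<nu> mult_mat_mult_vec)
    then have BGv: "B *\<^sub>v (G *\<^sub>v v) = v" by (simp only: BGB \<nu>)
    have dv: "dim_vec v = n" by (simp add: \<nu>)
    have "v - B *\<^sub>v (G *\<^sub>v v) = 0\<^sub>v n" unfolding BGv using dv by (intro eq_vecI) auto
    then show ?thesis using vy[OF dv] by (simp only:) simp
  qed
  then have "b \<bullet> y = 0" using perp[of y] by simp
  then have "r \<bullet> r = 0" using vy[of b] by (simp add: r_def[symmetric])
  then have "r = 0\<^sub>v n" using conjugate_square_eq_0_vec[of r n] by simp
  then have "b - B *\<^sub>v (G *\<^sub>v b) = 0\<^sub>v n" by (simp only: r_def)
  then have "b = B *\<^sub>v (G *\<^sub>v b)"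
    by (rule eq_vec_if_minus_eq_0[of b _ n]) simp_all
  moreover have "G *\<^sub>v b \<in> carrier_vec k" by simp
  ultimately show ?thesis unfolding VB by blast
qed

section \<open>Affine relations and their solution maps\<close>

text \<open>Closure under adding a multiple of a difference needs no base point. The empty relation
  thus counts as affine, and composition preserves the property even when it produces the empty
  relation.\<close>

definition affine_rel :: "nat \<Rightarrow> nat \<Rightarrow> real vec rel \<Rightarrow> bool" where
  "affine_rel m n R \<longleftrightarrow> R \<subseteq> carrier_vec m \<times> carrier_vec n \<and>
     (\<forall>a b a' b' a'' b'' c. (a, b) \<in> R \<and> (a', b') \<in> R \<and> (a'', b'') \<in> R \<longrightarrow>
        (a + c \<cdot>\<^sub>v (a' - a''), b + c \<cdot>\<^sub>v (b' - b'')) \<in> R)"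

lemma affine_relD:
  assumes "affine_rel m n R"
  shows "(a, b) \<in> R \<Longrightarrow> dim_vec a = m" "(a, b) \<in> R \<Longrightarrow> dim_vec b = n"
    "(a, b) \<in> R \<Longrightarrow> (a', b') \<in> R \<Longrightarrow> (a'', b'') \<in> R \<Longrightarrow>
       (a + c \<cdot>\<^sub>v (a' - a''), b + c \<cdot>\<^sub>v (b' - b'')) \<in> R"
  using assms unfolding affine_rel_def by (fastforce, fastforce, blast)

text \<open>The intermediate points combine with the same coefficient:
  \<open>j + c \<cdot>\<^sub>v (j' - j'')\<close> links the combined endpoints.\<close>

lemma affine_rel_comp:
  assumes R: "affine_rel m n R" and S: "affine_rel n k S"
  shows "affine_rel m k (R O S)"
  unfolding affine_rel_def
proof (intro conjI allI impI)
  show "R O S \<subseteq> carrier_vec m \<times> carrier_vec k"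
    using R S unfolding affine_rel_def by blast
next
  fix a b a' b' a'' b'' c
  assume "(a, b) \<in> R O S \<and> (a', b') \<in> R O S \<and> (a'', b'') \<in> R O S"
  then obtain j j' j'' where "(a, j) \<in> R" "(j, b) \<in> S" "(a', j') \<in> R" "(j', b') \<in> S"
    "(a'', j'') \<in> R" "(j'', b'') \<in> S" by blast
  then show "(a + c \<cdot>\<^sub>v (a' - a''), b + c \<cdot>\<^sub>v (b' - b'')) \<in> R O S"
    using affine_relD(3)[OF R] affine_relD(3)[OF S] by (meson relcomp.relcompI)
qed

lemma append_rows_mult_vec:
  fixes A B :: "real mat"
  assumes "dim_col A = dim_vec v" "dim_col B = dim_vec v"
  shows "(A @\<^sub>r B) *\<^sub>v v = (A *\<^sub>v v) @\<^sub>v (B *\<^sub>v v)"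
  using assms by (intro mat_mult_append[of A "dim_row A" "dim_vec v" B "dim_row B"]) simp_all

lemma append_vec_eq_iff:
  "dim_vec a = dim_vec a' \<Longrightarrow> a @\<^sub>v b = a' @\<^sub>v b' \<longleftrightarrow> a = a' \<and> b = b'"
  by (rule append_vec_eq[of _ "dim_vec a"]) simp_all

lemma append_vec_combination:
  fixes a :: "real vec"
  assumes "dim_vec a' = dim_vec a" "dim_vec b' = dim_vec b"
  shows "(a @\<^sub>v b) + (a' @\<^sub>v b') = (a + a') @\<^sub>v (b + b')"
    and "(a @\<^sub>v b) - (a' @\<^sub>v b') = (a - a') @\<^sub>v (b - b')"
    and "c \<cdot>\<^sub>v (a @\<^sub>v b) = (c \<cdot>\<^sub>v a) @\<^sub>v (c \<cdot>\<^sub>v b)"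
  using assms by (intro eq_vecI; simp)+

lemma eq_vec_if_minus_eq:
  fixes a b c :: "real vec"
  assumes "a - c = b - c" "dim_vec a = dim_vec c" "dim_vec b = dim_vec c"
  shows "a = b"
proof (rule eq_vecI)
  fix i assume "i < dim_vec b"
  then show "a $ i = b $ i" using arg_cong[OF assms(1), of "\<lambda>v. v $ i"] assms(2,3) by simp
qed (simp add: assms)

lemma mat_split_rows:
  fixes B :: "real mat"
  assumes "dim_row B = m + n"
  obtains B1 B2 where "dim_row B1 = m" "dim_row B2 = n" "dim_col B1 = dim_col B" "dim_col B2 = dim_col B"
    "B = B1 @\<^sub>r B2"
proof
  show "B = mat m (dim_col B) (\<lambda>(i, j). B $$ (i, j)) @\<^sub>r mat n (dim_col B) (\<lambda>(i, j). B $$ (m + i, j))"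
    using assms by (intro eq_matI) (auto simp: append_rows_def)
qed simp_all

text \<open>After translation by a base triple, the triples of left end, right end and shared point
  form a subspace, hence a column range. Recovering the shared point means solving for the
  coefficients from the ends, up to the kernel of that system; a generalized inverse does this by
  matrices that do not depend on the ends.\<close>

lemma affine_solution_map:
  assumes R: "affine_rel m n R" and S: "affine_rel n k S"
  obtains P p Z where "P \<in> carrier_mat n (m + k)" "p \<in> carrier_vec n" "Z \<in> carrier_mat n (dim_col Z)"
    "\<forall>(a, b) \<in> R O S.
       {P *\<^sub>v (a @\<^sub>v b) + p + Z *\<^sub>v \<rho> | \<rho>. \<rho> \<in> carrier_vec (dim_col Z)} =
       {j. (a, j) \<in> R \<and> (j, b) \<in> S}"
proof (cases "R O S = {}")
  case True
  \<comment> \<open>There is no pair to match, so zero data of the right shape do.\<close>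
  show ?thesis by (rule that[of "0\<^sub>m n (m + k)" "0\<^sub>v n" "0\<^sub>m n 0"]) (simp_all add: True)
next
  case False
  then obtain a0 j0 b0 where 0: "(a0, j0) \<in> R" "(j0, b0) \<in> S" by blast
  note Rd = affine_relD[OF R] and Sd = affine_relD[OF S]
  have [simp]: "dim_vec a0 = m" "dim_vec j0 = n" "dim_vec b0 = k" using 0 Rd(1,2) Sd(1,2) by blast+
  \<comment> \<open>The outer ends come first, so that the rows of \<open>B\<close> split into the
    known part \<open>B1\<close> and the wanted part \<open>B2\<close>.\<close>
  define V where "V = {((a - a0) @\<^sub>v (b - b0)) @\<^sub>v (j - j0) | a j b. (a, j) \<in> R \<and> (j, b) \<in> S}"
  have "vec_subspace (m + k + n) V"
    unfolding vec_subspace_def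
  proof (intro conjI ballI allI)
    show "V \<subseteq> carrier_vec (m + k + n)" by (auto simp: V_def)
    have "0\<^sub>v (m + k + n) = ((a0 - a0) @\<^sub>v (b0 - b0)) @\<^sub>v (j0 - j0)"
      by (intro eq_vecI) auto
    then show "0\<^sub>v (m + k + n) \<in> V" unfolding V_def using 0 by blast
    fix v w c assume "v \<in> V" "w \<in> V"
    then obtain a j b a' j' b' where *: "(a, j) \<in> R" "(j, b) \<in> S" "(a', j') \<in> R" "(j', b') \<in> S"
      and v: "v = ((a - a0) @\<^sub>v (b - b0)) @\<^sub>v (j - j0)"
      and w: "w = ((a' - a0) @\<^sub>v (b' - b0)) @\<^sub>v (j' - j0)"
      unfolding V_def by blast
    have [simp]: "dim_vec a = m" "dim_vec j = n" "dim_vec b = k"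
      "dim_vec a' = m" "dim_vec j' = n" "dim_vec b' = k"
      using Rd(1,2)[OF *(1)] Rd(1,2)[OF *(3)] Sd(2)[OF *(2)] Sd(2)[OF *(4)] by simp_all
    have "v + c \<cdot>\<^sub>v w = ((a + c \<cdot>\<^sub>v (a' - a0) - a0) @\<^sub>v (b + c \<cdot>\<^sub>v (b' - b0) - b0)) @\<^sub>v (j + c \<cdot>\<^sub>v (j' - j0) - j0)"
      unfolding v w by (intro eq_vecI) auto
    then show "v + c \<cdot>\<^sub>v w \<in> V"
      unfolding V_def using Rd(3)[OF *(1,3) 0(1)] Sd(3)[OF *(2,4) 0(2)] by blast
  qed
  then obtain q B where Bd: "B \<in> carrier_mat (m + k + n) q" and VB: "V = {B *\<^sub>v \<nu> | \<nu>. \<nu> \<in> carrier_vec q}"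
    by (rule vec_subspace_range)
  obtain B1 B2 where B1: "dim_row B1 = m + k" and B2: "dim_row B2 = n"
    and cols: "dim_col B1 = dim_col B" "dim_col B2 = dim_col B" and B: "B = B1 @\<^sub>r B2"
    using mat_split_rows[of B "m + k" n] Bd by auto
  have q: "dim_col B = q" using Bd by simp
  note [simp] = B1 B2 cols[unfolded q]
  have Bv: "B *\<^sub>v \<nu> = (B1 *\<^sub>v \<nu>) @\<^sub>v (B2 *\<^sub>v \<nu>)" if "dim_vec \<nu> = q" for \<nu>
    unfolding B using that by (intro append_rows_mult_vec) simp_all
  have V_iff: "((a - a0) @\<^sub>v (b - b0)) @\<^sub>v (j - j0) \<in> V \<longleftrightarrow> (a, j) \<in> R \<and> (j, b) \<in> S"
    if [simp]: "dim_vec a = m" "dim_vec b = k" "dim_vec j = n" for a b j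
  proof
    assume "((a - a0) @\<^sub>v (b - b0)) @\<^sub>v (j - j0) \<in> V"
    then obtain a' j' b' where *: "(a', j') \<in> R" "(j', b') \<in> S"
      and "((a - a0) @\<^sub>v (b - b0)) @\<^sub>v (j - j0) = ((a' - a0) @\<^sub>v (b' - b0)) @\<^sub>v (j' - j0)"
      unfolding V_def by blast
    moreover have [simp]: "dim_vec a' = m" "dim_vec j' = n" "dim_vec b' = k" using * Rd(1,2) Sd(1,2) by blast+
    ultimately have "a - a0 = a' - a0" "b - b0 = b' - b0" "j - j0 = j' - j0"
      by (simp_all add: append_vec_eq_iff)
    then have "a = a'" "b = b'" "j = j'" by (auto elim!: eq_vec_if_minus_eq)
    with * show "(a, j) \<in> R \<and> (j, b) \<in> S" by simp
  qed (auto simp: V_def)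
  obtain G where Gd: "G \<in> carrier_mat q (m + k)" and BGB: "B1 * G * B1 = B1"
    by (rule generalized_inverse[of B1 "m + k" q]) simp_all
  note [simp] = Gd[simplified]
  \<comment> \<open>The solutions of \<open>B1 *\<^sub>v \<nu> = d\<close> are
    \<open>G *\<^sub>v d\<close> plus any \<open>\<rho>\<close> minus its image under
    \<open>G * B1\<close>. Pushing them through \<open>B2\<close> gives \<open>P\<close> and
    \<open>Z\<close>; \<open>p\<close> absorbs the base triple.\<close>
  define P where "P = B2 * G"
  define p where "p = j0 - P *\<^sub>v (a0 @\<^sub>v b0)"
  define Z where "Z = B2 - B2 * (G * B1)"
  have [simp]: "dim_row P = n" "dim_col P = m + k" "dim_vec p = n" "dim_row Z = n" "dim_col Z = q"
    by (simp_all add: P_def p_def Z_def)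
  have map: "P *\<^sub>v (a @\<^sub>v b) + p + Z *\<^sub>v \<rho>
      = j0 + B2 *\<^sub>v (G *\<^sub>v ((a - a0) @\<^sub>v (b - b0)) + (\<rho> - G *\<^sub>v (B1 *\<^sub>v \<rho>)))"
    if [simp]: "dim_vec a = m" "dim_vec b = k" "dim_vec \<rho> = q" for a b \<rho>
    unfolding p_def Z_def P_def
    \<comment> \<open>Here and later \<open>index_mult_mat_vec\<close> is removed so that entries of
      products stay atoms. After linear expansion only real arithmetic remains.\<close>
    by (intro eq_vecI) (simp_all add: append_vec_combination(2)[symmetric] mult_mat_vec_linear del: index_mult_mat_vec)
  have sol: "{P *\<^sub>v (a @\<^sub>v b) + p + Z *\<^sub>v \<rho> | \<rho>. \<rho> \<in> carrier_vec (dim_col Z)}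
        = {j. (a, j) \<in> R \<and> (j, b) \<in> S}" if ab: "(a, b) \<in> R O S" for a b
  proof -
    from ab obtain j1 where j1: "(a, j1) \<in> R" "(j1, b) \<in> S" by blast
    have [simp]: "dim_vec a = m" "dim_vec b = k" "dim_vec j1 = n" using j1 Rd(1,2) Sd(1,2) by blast+
    let ?d = "(a - a0) @\<^sub>v (b - b0)"
    have key: "\<exists>\<nu>. dim_vec \<nu> = q \<and> ?d = B1 *\<^sub>v \<nu> \<and> j - j0 = B2 *\<^sub>v \<nu>"
      if "(a, j) \<in> R" "(j, b) \<in> S" for j
    proof -
      have [simp]: "dim_vec j = n" using that Rd by blast
      have "?d @\<^sub>v (j - j0) \<in> V" using V_iff[of a b j] that by simp
      then obtain \<nu> where "dim_vec \<nu> = q" "?d @\<^sub>v (j - j0) = B *\<^sub>v \<nu>" unfolding VB by auto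
      then show ?thesis by (auto simp: Bv append_vec_eq_iff)
    qed
    obtain \<nu>0 where [simp]: "dim_vec \<nu>0 = q" and d: "?d = B1 *\<^sub>v \<nu>0" using key[OF j1] by blast
    show ?thesis
    proof (intro equalityI subsetI)
      fix j assume "j \<in> {P *\<^sub>v (a @\<^sub>v b) + p + Z *\<^sub>v \<rho> | \<rho>. \<rho> \<in> carrier_vec (dim_col Z)}"
      then obtain \<rho> where [simp]: "dim_vec \<rho> = q" and "j = P *\<^sub>v (a @\<^sub>v b) + p + Z *\<^sub>v \<rho>" by auto
      define \<nu> where "\<nu> = G *\<^sub>v ?d + (\<rho> - G *\<^sub>v (B1 *\<^sub>v \<rho>))"
      have j: "j = j0 + B2 *\<^sub>v \<nu>" unfolding \<nu>_def \<open>j = _\<close> by (rule map) simp_all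
      have [simp]: "dim_vec \<nu> = q" by (simp add: \<nu>_def)
      have BG: "B1 *\<^sub>v (G *\<^sub>v (B1 *\<^sub>v w)) = B1 *\<^sub>v w" if "dim_vec w = q" for w
        using that arg_cong[OF BGB, of "\<lambda>M. M *\<^sub>v w"] by (simp add: mult_mat_mult_vec)
      have "B1 *\<^sub>v \<nu> = B1 *\<^sub>v \<nu>0"
        unfolding \<nu>_def d by (intro eq_vecI) (simp_all add: mult_mat_vec_linear BG del: index_mult_mat_vec)
      then have "((a - a0) @\<^sub>v (b - b0)) @\<^sub>v (j - j0) = B *\<^sub>v \<nu>"
        using d by (simp add: Bv append_vec_eq_iff) (auto simp: j)
      then have "((a - a0) @\<^sub>v (b - b0)) @\<^sub>v (j - j0) \<in> V" unfolding VB by auto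
      then show "j \<in> {j. (a, j) \<in> R \<and> (j, b) \<in> S}" by (subst (asm) V_iff) (simp_all add: j)
    next
      fix j assume "j \<in> {j. (a, j) \<in> R \<and> (j, b) \<in> S}"
      then have j: "(a, j) \<in> R" "(j, b) \<in> S" by simp_all
      then have [simp]: "dim_vec j = n" using Rd by blast
      obtain \<nu> where [simp]: "dim_vec \<nu> = q" and \<nu>: "?d = B1 *\<^sub>v \<nu>" "j - j0 = B2 *\<^sub>v \<nu>"
        using key[OF j] by blast
      \<comment> \<open>The coefficient vector \<open>\<nu>\<close> itself serves as free
        coordinate: the ends are given by \<open>B1 *\<^sub>v \<nu>\<close>, so the two terms with
        \<open>G\<close> cancel.\<close>
      have "P *\<^sub>v (a @\<^sub>v b) + p + Z *\<^sub>v \<nu> = j0 + B2 *\<^sub>v (G *\<^sub>v ?d + (\<nu> - G *\<^sub>v (B1 *\<^sub>v \<nu>)))"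
        by (rule map) simp_all
      also have "G *\<^sub>v ?d + (\<nu> - G *\<^sub>v (B1 *\<^sub>v \<nu>)) = \<nu>"
        unfolding \<nu>(1) by (intro eq_vecI) auto
      also have "j0 + B2 *\<^sub>v \<nu> = j" unfolding \<nu>(2)[symmetric] by (intro eq_vecI) auto
      finally show "j \<in> {P *\<^sub>v (a @\<^sub>v b) + p + Z *\<^sub>v \<rho> | \<rho>. \<rho> \<in> carrier_vec (dim_col Z)}" by force
    qed
  qed
  show ?thesis by (rule that[of P p Z]) (use sol in auto)
qed

section \<open>Contraction and expansion trees\<close>

text \<open>The label occurs once in the interval, so the split around it is unique. Tree inductions
  thereby recover the interval of each subtree from its inorder list.\<close>

lemma append_Cons_eq_upt:
  assumes "xs @ j # ys = [Suc a..<b]"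
  shows "a < j" "j < b" "xs = [Suc a..<j]" "ys = [Suc j..<b]"
proof -
  have "j \<in> set [Suc a..<b]" unfolding assms[symmetric] by simp
  then show "a < j" "j < b" by auto
  then have "[Suc a..<b] = [Suc a..<j] @ j # [Suc j..<b]"
    using upt_add_eq_append[of "Suc a" j "b - j"] upt_conv_Cons[of j b] by simp
  then have eq: "xs @ j # ys = [Suc a..<j] @ j # [Suc j..<b]" using assms by simp
  have "distinct (xs @ j # ys)" unfolding assms by simp
  then have "j \<notin> set xs" "j \<notin> set ys" by auto
  from append_Cons_eq_iff[OF this] eq show "xs = [Suc a..<j]" "ys = [Suc j..<b]" by blast+
qed

lemma inorder_Leaf_upt:
  assumes "inorder (Leaf :: nat tree) = [Suc a..<b]" "a < b"
  shows "b = Suc a"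
proof -
  have "[Suc a..<b] = []" using assms(1) by simp
  then show ?thesis using assms(2) by (simp only: upt_eq_Nil_conv) linarith
qed

lemma affine_tree_rel:
  assumes "\<And>i. a \<le> i \<Longrightarrow> i < b \<Longrightarrow> affine_rel (n i) (n (Suc i)) (\<D> i)"
    and "inorder \<tau> = [Suc a..<b]" "a < b"
  shows "affine_rel (n a) (n b) (tree_rel \<D> a \<tau>)"
  using assms
proof (induction \<tau> arbitrary: a b)
  case Leaf
  then show ?case using inorder_Leaf_upt[OF Leaf.prems(2,3)] by simp
next
  case (Node l j r)
  have s: "a < j" "j < b" "inorder l = [Suc a..<j]" "inorder r = [Suc j..<b]"
    using append_Cons_eq_upt[of "inorder l" j "inorder r" a b] Node.prems(2) by simp_all
  have "affine_rel (n a) (n j) (tree_rel \<D> a l)" by (rule Node.IH(1)) (use s Node.prems(1) in auto)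
  moreover have "affine_rel (n j) (n b) (tree_rel \<D> j r)" by (rule Node.IH(2)) (use s Node.prems(1) in auto)
  ultimately show ?case using affine_rel_comp by auto
qed

text \<open>Allows maps found independently for the two subtrees of a node to be glued.\<close>

lemma solution_maps_cong:
  assumes "\<And>j. j \<in> set (inorder \<tau>) \<Longrightarrow> \<P> j = \<P>' j \<and> \<p> j = \<p>' j \<and> \<Z> j = \<Z>' j"
  shows "solution_maps n \<D> \<P> \<p> \<Z> a b \<tau> \<longleftrightarrow> solution_maps n \<D> \<P>' \<p>' \<Z>' a b \<tau>"
  using assms by (induction \<tau> arbitrary: a b) simp_all

lemma solution_maps_exist:
  assumes "\<And>i. a \<le> i \<Longrightarrow> i < b \<Longrightarrow> affine_rel (n i) (n (Suc i)) (\<D> i)"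
    and "inorder \<tau> = [Suc a..<b]" "a < b"
  shows "\<exists>\<P> \<p> \<Z>. solution_maps n \<D> \<P> \<p> \<Z> a b \<tau>"
  using assms
proof (induction \<tau> arbitrary: a b)
  case Leaf
  then show ?case by simp
next
  case (Node l j r)
  have s: "a < j" "j < b" "inorder l = [Suc a..<j]" "inorder r = [Suc j..<b]"
    using append_Cons_eq_upt[of "inorder l" j "inorder r" a b] Node.prems(2) by simp_all
  have D: "\<And>i. a \<le> i \<Longrightarrow> i < j \<Longrightarrow> affine_rel (n i) (n (Suc i)) (\<D> i)"
    "\<And>i. j \<le> i \<Longrightarrow> i < b \<Longrightarrow> affine_rel (n i) (n (Suc i)) (\<D> i)" using s Node.prems(1) by auto
  obtain P1 p1 Z1 where l: "solution_maps n \<D> P1 p1 Z1 a j l" using Node.IH(1)[OF D(1) s(3,1)] by blast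
  obtain P2 p2 Z2 where r: "solution_maps n \<D> P2 p2 Z2 j b r" using Node.IH(2)[OF D(2) s(4,2)] by blast
  have al: "affine_rel (n a) (n j) (tree_rel \<D> a l)" by (rule affine_tree_rel) (use D s in auto)
  have ar: "affine_rel (n j) (n b) (tree_rel \<D> j r)" by (rule affine_tree_rel) (use D s in auto)
  obtain P p Z where m: "P \<in> carrier_mat (n j) (n a + n b)" "p \<in> carrier_vec (n j)" "Z \<in> carrier_mat (n j) (dim_col Z)"
    "\<forall>(la, lb) \<in> tree_rel \<D> a l O tree_rel \<D> j r.
       {P *\<^sub>v (la @\<^sub>v lb) + p + Z *\<^sub>v \<rho> | \<rho>. \<rho> \<in> carrier_vec (dim_col Z)} =
       {lj. (la, lj) \<in> tree_rel \<D> a l \<and> (lj, lb) \<in> tree_rel \<D> j r}"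
    by (rule affine_solution_map[OF al ar])
  \<comment> \<open>Left labels are below \<open>j\<close> and right labels above it, so a
    comparison with \<open>j\<close> decides which maps to use.\<close>
  define \<P> where "\<P> i = (if i < j then P1 i else if i = j then P else P2 i)" for i
  define \<p> where "\<p> i = (if i < j then p1 i else if i = j then p else p2 i)" for i
  define \<Z> where "\<Z> i = (if i < j then Z1 i else if i = j then Z else Z2 i)" for i
  have "solution_maps n \<D> \<P> \<p> \<Z> a j l"
    by (rule iffD1[OF solution_maps_cong l]) (auto simp: s \<P>_def \<p>_def \<Z>_def)
  moreover have "solution_maps n \<D> \<P> \<p> \<Z> j b r"
    by (rule iffD1[OF solution_maps_cong r]) (auto simp: s \<P>_def \<p>_def \<Z>_def)
  moreover have "\<P> j = P" "\<p> j = p" "\<Z> j = Z" by (simp_all add: \<P>_def \<p>_def \<Z>_def)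
  ultimately have "solution_maps n \<D> \<P> \<p> \<Z> a b \<langle>l, j, r\<rangle>"
    unfolding solution_maps.simps tree_rel.simps using m by simp
  then show ?case by blast
qed

lemma tree_rel_if_chain:
  assumes "\<And>i. a \<le> i \<Longrightarrow> i < b \<Longrightarrow> (lam i, lam (Suc i)) \<in> \<D> i"
    and "inorder \<tau> = [Suc a..<b]" "a < b"
  shows "(lam a, lam b) \<in> tree_rel \<D> a \<tau>"
  using assms
proof (induction \<tau> arbitrary: a b)
  case Leaf
  then show ?case using inorder_Leaf_upt[OF Leaf.prems(2,3)] by simp
next
  case (Node l j r)
  have s: "a < j" "j < b" "inorder l = [Suc a..<j]" "inorder r = [Suc j..<b]"
    using append_Cons_eq_upt[of "inorder l" j "inorder r" a b] Node.prems(2) by simp_all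
  have "(lam a, lam j) \<in> tree_rel \<D> a l" by (rule Node.IH(1)) (use s Node.prems(1) in auto)
  moreover have "(lam j, lam b) \<in> tree_rel \<D> j r" by (rule Node.IH(2)) (use s Node.prems(1) in auto)
  ultimately show ?case by auto
qed

text \<open>Labels lie strictly between \<open>a\<close> and \<open>b\<close>. Hence costates fixed
  by an ancestor survive, and expanding one subtree does not disturb its sibling.\<close>

lemma expand_outside:
  assumes "inorder \<tau> = [Suc a..<b]" "a < b" "i \<le> a \<or> b \<le> i"
  shows "expand \<P> \<p> \<Z> a b \<tau> lam i = lam i"
  using assms
proof (induction \<tau> arbitrary: a b lam)
  case (Node l j r)
  have s: "a < j" "j < b" "inorder l = [Suc a..<j]" "inorder r = [Suc j..<b]"
    using append_Cons_eq_upt[of "inorder l" j "inorder r" a b] Node.prems(1) by simp_all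
  have "i \<le> a \<or> j \<le> i" "i \<le> j \<or> b \<le> i" "i \<noteq> j" using s Node.prems(3) by auto
  then show ?case using Node.IH(1)[OF s(3,1)] Node.IH(2)[OF s(4,2)] by (simp add: Let_def)
qed simp

text \<open>The stored map puts the new costate into both child relations, so each child meets the
  hypothesis of the induction with its own endpoints.\<close>

lemma expand_chain:
  assumes "solution_maps n \<D> \<P> \<p> \<Z> a b \<tau>"
    and "inorder \<tau> = [Suc a..<b]" "a < b" "(lam a, lam b) \<in> tree_rel \<D> a \<tau>" "a \<le> i" "i < b"
  shows "(expand \<P> \<p> \<Z> a b \<tau> lam i, expand \<P> \<p> \<Z> a b \<tau> lam (Suc i)) \<in> \<D> i"
  using assms
proof (induction \<tau> arbitrary: a b lam i)
  case Leaf
  then have "b = Suc a" "i = a" using inorder_Leaf_upt[OF Leaf.prems(2,3)] by simp_all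
  with Leaf show ?case by simp
next
  case (Node l j r)
  have s: "a < j" "j < b" "inorder l = [Suc a..<j]" "inorder r = [Suc j..<b]"
    using append_Cons_eq_upt[of "inorder l" j "inorder r" a b] Node.prems(2) by simp_all
  define m where "m = \<P> j *\<^sub>v (lam a @\<^sub>v lam b) + \<p> j + \<Z> j *\<^sub>v 0\<^sub>v (dim_col (\<Z> j))"
  define lam1 where "lam1 = lam(j := m)"
  define lam2 where "lam2 = expand \<P> \<p> \<Z> a j l lam1"
  define lam3 where "lam3 = expand \<P> \<p> \<Z> j b r lam2"
  have maps: "solution_maps n \<D> \<P> \<p> \<Z> a j l" "solution_maps n \<D> \<P> \<p> \<Z> j b r"
    and sol: "\<forall>(la, lb) \<in> tree_rel \<D> a \<langle>l, j, r\<rangle>.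
         {\<P> j *\<^sub>v (la @\<^sub>v lb) + \<p> j + \<Z> j *\<^sub>v \<rho> | \<rho>. \<rho> \<in> carrier_vec (dim_col (\<Z> j))} =
         {lj. (la, lj) \<in> tree_rel \<D> a l \<and> (lj, lb) \<in> tree_rel \<D> j r}"
    using Node.prems(1) unfolding solution_maps.simps by blast+
  from bspec[OF sol Node.prems(4)]
  have "{\<P> j *\<^sub>v (lam a @\<^sub>v lam b) + \<p> j + \<Z> j *\<^sub>v \<rho> | \<rho>. \<rho> \<in> carrier_vec (dim_col (\<Z> j))} =
         {lj. (lam a, lj) \<in> tree_rel \<D> a l \<and> (lj, lam b) \<in> tree_rel \<D> j r}"
    by (simp only: split_conv)
  \<comment> \<open>Zero free coordinates are one admissible choice of
    \<open>\<rho>\<close>.\<close>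
  moreover have "m \<in> {\<P> j *\<^sub>v (lam a @\<^sub>v lam b) + \<p> j + \<Z> j *\<^sub>v \<rho> | \<rho>. \<rho> \<in> carrier_vec (dim_col (\<Z> j))}"
    unfolding m_def using zero_carrier_vec by blast
  ultimately have m: "(lam a, m) \<in> tree_rel \<D> a l" "(m, lam b) \<in> tree_rel \<D> j r" by simp_all
  have out2: "k \<le> a \<or> j \<le> k \<Longrightarrow> lam2 k = lam1 k" for k
    unfolding lam2_def by (rule expand_outside[OF s(3,1)])
  have out3: "k \<le> j \<or> b \<le> k \<Longrightarrow> lam3 k = lam2 k" for k
    unfolding lam3_def by (rule expand_outside[OF s(4,2)])
  have "(lam3 i, lam3 (Suc i)) \<in> \<D> i"
  proof (cases "i < j")
    case True
    have "(lam2 i, lam2 (Suc i)) \<in> \<D> i"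
      unfolding lam2_def using m s True Node.prems(5) by (intro Node.IH(1) maps) (simp_all add: lam1_def)
    \<comment> \<open>The index \<open>Suc i\<close> may be \<open>j\<close> itself, which the right
      expansion leaves unchanged too.\<close>
    then show ?thesis using out3[of i] out3[of "Suc i"] True by simp
  next
    case False
    have "(lam2 j, lam2 b) \<in> tree_rel \<D> j r" using out2[of j] out2[of b] s m by (simp add: lam1_def)
    then show ?thesis
      unfolding lam3_def using s False Node.prems(6) by (intro Node.IH(2) maps) simp_all
  qed
  then show ?case by (simp add: Let_def lam3_def lam2_def lam1_def m_def)
qed

section \<open>Dimensions of the data, and affinity of the leaf relations\<close>

lemma lqr_problemD:
  assumes "lqr_problem P"
  shows "1 \<le> hor P" "dim_vec (init P) = sdim P 0"
    "i \<le> hor P \<Longrightarrow> dim_row (matQ P i) = sdim P i" "i \<le> hor P \<Longrightarrow> dim_col (matQ P i) = sdim P i"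
    "i \<le> hor P \<Longrightarrow> dim_vec (vecq P i) = sdim P i"
    "i \<le> hor P \<Longrightarrow> dim_row (matE P i) = edim P i" "i \<le> hor P \<Longrightarrow> dim_col (matE P i) = sdim P i"
    "i \<le> hor P \<Longrightarrow> dim_vec (vece P i) = edim P i"
    "i < hor P \<Longrightarrow> dim_row (matM P i) = sdim P i" "i < hor P \<Longrightarrow> dim_col (matM P i) = udim P i"
    "i < hor P \<Longrightarrow> dim_row (matR P i) = udim P i" "i < hor P \<Longrightarrow> dim_col (matR P i) = udim P i"
    "i < hor P \<Longrightarrow> dim_vec (vecr P i) = udim P i"
    "i < hor P \<Longrightarrow> dim_row (matA P i) = sdim P (Suc i)" "i < hor P \<Longrightarrow> dim_col (matA P i) = sdim P i"
    "i < hor P \<Longrightarrow> dim_row (matB P i) = sdim P (Suc i)" "i < hor P \<Longrightarrow> dim_col (matB P i) = udim P i"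
    "i < hor P \<Longrightarrow> dim_vec (vecc P i) = sdim P (Suc i)"
    "i < hor P \<Longrightarrow> dim_row (matC P i) = cdim P i" "i < hor P \<Longrightarrow> dim_col (matC P i) = sdim P i"
    "i < hor P \<Longrightarrow> dim_row (matD P i) = cdim P i" "i < hor P \<Longrightarrow> dim_col (matD P i) = udim P i"
    "i < hor P \<Longrightarrow> dim_vec (vecd P i) = cdim P i"
  using assms unfolding lqr_problem_def by simp_all

lemma lqr_problem_symmetric:
  assumes "lqr_problem P"
  shows "i \<le> hor P \<Longrightarrow> (matQ P i)\<^sup>T = matQ P i" "i < hor P \<Longrightarrow> (matR P i)\<^sup>T = matR P i"
  using assms unfolding lqr_problem_def by blast+

abbreviation grad_x :: "lqr \<Rightarrow> (nat \<Rightarrow> real vec) \<Rightarrow> (nat \<Rightarrow> real vec) \<Rightarrow> nat \<Rightarrow> real vec" where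
  "grad_x P x u i \<equiv> matQ P i *\<^sub>v x i + matM P i *\<^sub>v u i + vecq P i"
abbreviation grad_u :: "lqr \<Rightarrow> (nat \<Rightarrow> real vec) \<Rightarrow> (nat \<Rightarrow> real vec) \<Rightarrow> nat \<Rightarrow> real vec" where
  "grad_u P x u i \<equiv> (matM P i)\<^sup>T *\<^sub>v x i + matR P i *\<^sub>v u i + vecr P i"
abbreviation grad_end :: "lqr \<Rightarrow> (nat \<Rightarrow> real vec) \<Rightarrow> real vec" where
  "grad_end P x \<equiv> matQ P (hor P) *\<^sub>v x (hor P) + vecq P (hor P)"

text \<open>The multipliers of the three given pairs are combined with the same coefficient as the
  costates. The gradient depends on neither, so it cancels in the difference and remains exactly
  once.\<close>

lemma affine_leaf_rel:
  assumes P: "lqr_problem P" and i: "i \<le> hor P"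
    and x: "dim_vec (x i) = sdim P i" and u: "i < hor P \<Longrightarrow> dim_vec (u i) = udim P i"
  shows "affine_rel (costate_dim P i) (costate_dim P (Suc i)) (leaf_rel P x u i)"
proof -
  note [simp] = lqr_problemD[OF P] x
  have "(a + c \<cdot>\<^sub>v (a' - a''), b + c \<cdot>\<^sub>v (b' - b'')) \<in> leaf_rel P x u i"
    if "(a, b) \<in> leaf_rel P x u i" "(a', b') \<in> leaf_rel P x u i" "(a'', b'') \<in> leaf_rel P x u i"
    for a b a' b' a'' b'' c
  proof (cases "i < hor P")
    case True
    note [simp] = True i u[OF True]
    have d: "costate_dim P i = sdim P i" "costate_dim P (Suc i) = sdim P (Suc i)"
      using True by (simp_all add: costate_dim_def Suc_le_eq i)
    have "\<exists>\<mu> \<eta>. stationary P x u i l l' \<mu> \<eta>" if "(l, l') \<in> leaf_rel P x u i" for l l'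
      using that True unfolding leaf_rel_def by simp
    with that obtain \<mu> \<eta> \<mu>' \<eta>' \<mu>'' \<eta>'' where s: "stationary P x u i a b \<mu> \<eta>" "stationary P x u i a' b' \<mu>' \<eta>'"
      "stationary P x u i a'' b'' \<mu>'' \<eta>''"
      by meson
    have [simp]: "dim_vec a = sdim P i" "dim_vec a' = sdim P i" "dim_vec a'' = sdim P i"
      "dim_vec b = sdim P (Suc i)" "dim_vec b' = sdim P (Suc i)" "dim_vec b'' = sdim P (Suc i)"
      using that by (simp_all add: leaf_rel_def d)
    have [simp]: "dim_vec \<mu> = cdim P i" "dim_vec \<mu>' = cdim P i" "dim_vec \<mu>'' = cdim P i"
      "dim_vec \<eta> = edim P i" "dim_vec \<eta>' = edim P i" "dim_vec \<eta>'' = edim P i"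
      using s by (simp_all add: stationary_def)
    define G where "G = grad_x P x u i"
    define H where "H = grad_u P x u i"
    have [simp]: "dim_vec G = sdim P i" "dim_vec H = udim P i" by (simp_all add: G_def H_def)
    have "stationary P x u i (a + c \<cdot>\<^sub>v (a' - a'')) (b + c \<cdot>\<^sub>v (b' - b''))
        (\<mu> + c \<cdot>\<^sub>v (\<mu>' - \<mu>'')) (\<eta> + c \<cdot>\<^sub>v (\<eta>' - \<eta>''))"
      unfolding stationary_def G_def[symmetric] H_def[symmetric]
    proof (intro conjI)
      let ?e = "\<lambda>a b \<mu> \<eta>. G - a + (matA P i)\<^sup>T *\<^sub>v b + (matC P i)\<^sup>T *\<^sub>v \<mu> + (matE P i)\<^sup>T *\<^sub>v \<eta>"
      have "?e (a + c \<cdot>\<^sub>v (a' - a'')) (b + c \<cdot>\<^sub>v (b' - b'')) (\<mu> + c \<cdot>\<^sub>v (\<mu>' - \<mu>'')) (\<eta> + c \<cdot>\<^sub>v (\<eta>' - \<eta>''))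
          = ?e a b \<mu> \<eta> + c \<cdot>\<^sub>v (?e a' b' \<mu>' \<eta>' - ?e a'' b'' \<mu>'' \<eta>'')"
        by (intro eq_vecI) (simp_all add: mult_mat_vec_linear algebra_simps del: index_mult_mat_vec)
      also have "\<dots> = 0\<^sub>v (sdim P i) + c \<cdot>\<^sub>v (0\<^sub>v (sdim P i) - 0\<^sub>v (sdim P i))"
        using s unfolding stationary_def G_def[symmetric] by (simp only:)
      also have "\<dots> = 0\<^sub>v (sdim P i)" by (intro eq_vecI) simp_all
      finally show "?e (a + c \<cdot>\<^sub>v (a' - a'')) (b + c \<cdot>\<^sub>v (b' - b'')) (\<mu> + c \<cdot>\<^sub>v (\<mu>' - \<mu>''))
        (\<eta> + c \<cdot>\<^sub>v (\<eta>' - \<eta>'')) = 0\<^sub>v (sdim P i)" .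
      let ?f = "\<lambda>b \<mu>. H + (matB P i)\<^sup>T *\<^sub>v b + (matD P i)\<^sup>T *\<^sub>v \<mu>"
      have "?f (b + c \<cdot>\<^sub>v (b' - b'')) (\<mu> + c \<cdot>\<^sub>v (\<mu>' - \<mu>'')) = ?f b \<mu> + c \<cdot>\<^sub>v (?f b' \<mu>' - ?f b'' \<mu>'')"
        by (intro eq_vecI) (simp_all add: mult_mat_vec_linear algebra_simps del: index_mult_mat_vec)
      also have "\<dots> = 0\<^sub>v (udim P i) + c \<cdot>\<^sub>v (0\<^sub>v (udim P i) - 0\<^sub>v (udim P i))"
        using s unfolding stationary_def H_def[symmetric] by (simp only:)
      also have "\<dots> = 0\<^sub>v (udim P i)" by (intro eq_vecI) simp_all
      finally show "?f (b + c \<cdot>\<^sub>v (b' - b'')) (\<mu> + c \<cdot>\<^sub>v (\<mu>' - \<mu>'')) = 0\<^sub>v (udim P i)" .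
    qed simp_all
    then show ?thesis by (auto simp: leaf_rel_def d)
  next
    case False
    then have i: "i = hor P" using i by simp
    have d: "costate_dim P i = sdim P i" "costate_dim P (Suc i) = 0"
      by (simp_all add: costate_dim_def i)
    have "\<exists>\<eta>. terminal_stationary P x l \<eta>" if "(l, l') \<in> leaf_rel P x u i" for l l'
      using that i unfolding leaf_rel_def by simp
    with that obtain \<eta> \<eta>' \<eta>'' where s: "terminal_stationary P x a \<eta>" "terminal_stationary P x a' \<eta>'"
      "terminal_stationary P x a'' \<eta>''"
      by meson
    have [simp]: "dim_vec a = sdim P i" "dim_vec a' = sdim P i" "dim_vec a'' = sdim P i"
      "dim_vec b = 0" "dim_vec b' = 0" "dim_vec b'' = 0"
      using that by (simp_all add: leaf_rel_def d)
    have [simp]: "dim_vec \<eta> = edim P i" "dim_vec \<eta>' = edim P i" "dim_vec \<eta>'' = edim P i"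
      using s by (simp_all add: terminal_stationary_def i)
    define G where "G = grad_end P x"
    have [simp]: "dim_vec G = sdim P i" by (simp add: G_def i)
    have "terminal_stationary P x (a + c \<cdot>\<^sub>v (a' - a'')) (\<eta> + c \<cdot>\<^sub>v (\<eta>' - \<eta>''))"
      unfolding terminal_stationary_def unfolding G_def[symmetric] unfolding i[symmetric]
    proof (intro conjI)
      let ?e = "\<lambda>a \<eta>. G - a + (matE P i)\<^sup>T *\<^sub>v \<eta>"
      have "?e (a + c \<cdot>\<^sub>v (a' - a'')) (\<eta> + c \<cdot>\<^sub>v (\<eta>' - \<eta>'')) = ?e a \<eta> + c \<cdot>\<^sub>v (?e a' \<eta>' - ?e a'' \<eta>'')"
        by (intro eq_vecI) (simp_all add: i mult_mat_vec_linear algebra_simps del: index_mult_mat_vec)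
      also have "\<dots> = 0\<^sub>v (sdim P i) + c \<cdot>\<^sub>v (0\<^sub>v (sdim P i) - 0\<^sub>v (sdim P i))"
        using s unfolding terminal_stationary_def G_def[symmetric] by (simp only: i)
      also have "\<dots> = 0\<^sub>v (sdim P i)" by (intro eq_vecI) simp_all
      finally show "?e (a + c \<cdot>\<^sub>v (a' - a'')) (\<eta> + c \<cdot>\<^sub>v (\<eta>' - \<eta>'')) = 0\<^sub>v (sdim P i)" .
    qed simp_all
    then show ?thesis by (auto simp: leaf_rel_def d i costate_dim_def)
  qed
  moreover have "leaf_rel P x u i \<subseteq> carrier_vec (costate_dim P i) \<times> carrier_vec (costate_dim P (Suc i))"
    unfolding leaf_rel_def by blast
  ultimately show ?thesis unfolding affine_rel_def by blast
qed

section \<open>First-order optimality\<close>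

lemma quadratic_nonneg_linear_coeff_zero:
  fixes L q :: real
  assumes "\<And>t. t * L + t\<^sup>2 * q \<ge> 0"
  shows "L = 0"
proof (rule ccontr)
  assume "L \<noteq> 0"
  \<comment> \<open>Small enough that at \<open>t = - s * L\<close> the linear decrease beats the
    quadratic term, whatever the sign of \<open>q\<close>.\<close>
  define s where "s = 1 / (1 + \<bar>q\<bar>)"
  have s: "s > 0" "s * \<bar>q\<bar> < 1" by (auto simp: s_def field_simps)
  have "(- s * L) * L + (- s * L)\<^sup>2 * q = s * L\<^sup>2 * (s * q - 1)"
    by (simp add: power2_eq_square algebra_simps)
  moreover have "s * q \<le> s * \<bar>q\<bar>" using s by (intro mult_left_mono) auto
  then have "s * q - 1 < 0" using s by linarith
  then have "s * L\<^sup>2 * (s * q - 1) < 0"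
    using s \<open>L \<noteq> 0\<close> by (intro mult_pos_neg) auto
  ultimately show False using assms[of "- s * L"] by linarith
qed

lemma quadratic_form_variation:
  fixes Q :: "real mat"
  assumes "Q\<^sup>T = Q" "dim_row Q = n" "dim_col Q = n" "dim_vec x = n" "dim_vec d = n"
  shows "(x + t \<cdot>\<^sub>v d) \<bullet> (Q *\<^sub>v (x + t \<cdot>\<^sub>v d))
    = x \<bullet> (Q *\<^sub>v x) + 2 * t * ((Q *\<^sub>v x) \<bullet> d) + t\<^sup>2 * (d \<bullet> (Q *\<^sub>v d))"
proof -
  note [simp] = assms(2-)
  have "x \<bullet> (Q *\<^sub>v d) = (Q *\<^sub>v x) \<bullet> d"
    using scalar_prod_transpose[of x Q d] by (simp add: assms(1))
  moreover have "d \<bullet> (Q *\<^sub>v x) = (Q *\<^sub>v x) \<bullet> d" by (rule scalar_prod_commute) simp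
  ultimately show ?thesis
    by (simp add: mult_mat_vec_linear scalar_prod_linear power2_eq_square algebra_simps)
qed

text \<open>The quadratic coefficient stays existential: its sign is unknown, and only the
  coefficient of \<open>t\<close> is used afterwards.\<close>

lemma stage_cost_variation:
  assumes P: "lqr_problem P" and i: "i < hor P"
    and dims: "dim_vec (x i) = sdim P i" "dim_vec (u i) = udim P i"
      "dim_vec d = sdim P i" "dim_vec w = udim P i"
  shows "\<exists>q. \<forall>t. stage_cost P i (x i + t \<cdot>\<^sub>v d) (u i + t \<cdot>\<^sub>v w) =
    stage_cost P i (x i) (u i) + t * (grad_x P x u i \<bullet> d + grad_u P x u i \<bullet> w) + t\<^sup>2 * q"
proof -
  note [simp] = lqr_problemD[OF P] dims i less_imp_le[OF i]
  have Q: "(x i + t \<cdot>\<^sub>v d) \<bullet> (matQ P i *\<^sub>v (x i + t \<cdot>\<^sub>v d)) =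
      x i \<bullet> (matQ P i *\<^sub>v x i) + 2 * t * ((matQ P i *\<^sub>v x i) \<bullet> d) + t\<^sup>2 * (d \<bullet> (matQ P i *\<^sub>v d))" for t
    by (rule quadratic_form_variation[where n = "sdim P i"]) (simp_all add: lqr_problem_symmetric[OF P])
  have R: "(u i + t \<cdot>\<^sub>v w) \<bullet> (matR P i *\<^sub>v (u i + t \<cdot>\<^sub>v w)) =
      u i \<bullet> (matR P i *\<^sub>v u i) + 2 * t * ((matR P i *\<^sub>v u i) \<bullet> w) + t\<^sup>2 * (w \<bullet> (matR P i *\<^sub>v w))" for t
    by (rule quadratic_form_variation[where n = "udim P i"]) (simp_all add: lqr_problem_symmetric[OF P])
  have "d \<bullet> (matM P i *\<^sub>v u i) = (matM P i *\<^sub>v u i) \<bullet> d" by (rule scalar_prod_commute) simp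
  moreover have "x i \<bullet> (matM P i *\<^sub>v w) = ((matM P i)\<^sup>T *\<^sub>v x i) \<bullet> w"
    by (rule scalar_prod_transpose[symmetric]) simp_all
  ultimately have M: "(x i + t \<cdot>\<^sub>v d) \<bullet> (matM P i *\<^sub>v (u i + t \<cdot>\<^sub>v w)) =
      x i \<bullet> (matM P i *\<^sub>v u i) + t * ((matM P i *\<^sub>v u i) \<bullet> d + ((matM P i)\<^sup>T *\<^sub>v x i) \<bullet> w)
      + t\<^sup>2 * (d \<bullet> (matM P i *\<^sub>v w))" for t
    by (simp add: mult_mat_vec_linear scalar_prod_linear power2_eq_square algebra_simps)
  have qr: "vecq P i \<bullet> (x i + t \<cdot>\<^sub>v d) = vecq P i \<bullet> x i + t * (vecq P i \<bullet> d)"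
    "vecr P i \<bullet> (u i + t \<cdot>\<^sub>v w) = vecr P i \<bullet> u i + t * (vecr P i \<bullet> w)" for t
    by (simp_all add: scalar_prod_linear)
  show ?thesis
    unfolding stage_cost_def Q R M qr
    by (intro exI[of _ "1/2 * (d \<bullet> (matQ P i *\<^sub>v d)) + d \<bullet> (matM P i *\<^sub>v w) + 1/2 * (w \<bullet> (matR P i *\<^sub>v w))"] allI)
       (simp add: scalar_prod_linear algebra_simps)
qed

lemma lqr_cost_variation:
  assumes P: "lqr_problem P"
    and dims: "\<And>i. i \<le> hor P \<Longrightarrow> dim_vec (x i) = sdim P i" "\<And>i. i < hor P \<Longrightarrow> dim_vec (u i) = udim P i"
      "\<And>i. i \<le> hor P \<Longrightarrow> dim_vec (d i) = sdim P i" "\<And>i. i < hor P \<Longrightarrow> dim_vec (w i) = udim P i"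
  shows "\<exists>q. \<forall>t. lqr_cost P (\<lambda>i. x i + t \<cdot>\<^sub>v d i) (\<lambda>i. u i + t \<cdot>\<^sub>v w i) = lqr_cost P x u
    + t * ((\<Sum>i<hor P. grad_x P x u i \<bullet> d i + grad_u P x u i \<bullet> w i) + grad_end P x \<bullet> d (hor P)) + t\<^sup>2 * q"
proof -
  note [simp] = lqr_problemD[OF P] dims
  have "\<forall>i. \<exists>q. i < hor P \<longrightarrow> (\<forall>t. stage_cost P i (x i + t \<cdot>\<^sub>v d i) (u i + t \<cdot>\<^sub>v w i) =
    stage_cost P i (x i) (u i) + t * (grad_x P x u i \<bullet> d i + grad_u P x u i \<bullet> w i) + t\<^sup>2 * q)"
    using stage_cost_variation[OF P] dims by (metis less_imp_le)
  then obtain q where q: "\<And>i t. i < hor P \<Longrightarrow> stage_cost P i (x i + t \<cdot>\<^sub>v d i) (u i + t \<cdot>\<^sub>v w i) =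
    stage_cost P i (x i) (u i) + t * (grad_x P x u i \<bullet> d i + grad_u P x u i \<bullet> w i) + t\<^sup>2 * q i"
    by metis
  let ?N = "hor P"
  have Q: "(x ?N + t \<cdot>\<^sub>v d ?N) \<bullet> (matQ P ?N *\<^sub>v (x ?N + t \<cdot>\<^sub>v d ?N)) =
      x ?N \<bullet> (matQ P ?N *\<^sub>v x ?N) + 2 * t * ((matQ P ?N *\<^sub>v x ?N) \<bullet> d ?N)
      + t\<^sup>2 * (d ?N \<bullet> (matQ P ?N *\<^sub>v d ?N))" for t
    by (rule quadratic_form_variation[where n = "sdim P ?N"]) (simp_all add: lqr_problem_symmetric[OF P])
  have "lqr_cost P (\<lambda>i. x i + t \<cdot>\<^sub>v d i) (\<lambda>i. u i + t \<cdot>\<^sub>v w i) = lqr_cost P x u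
    + t * ((\<Sum>i<?N. grad_x P x u i \<bullet> d i + grad_u P x u i \<bullet> w i) + grad_end P x \<bullet> d ?N)
    + t\<^sup>2 * ((\<Sum>i<?N. q i) + 1/2 * (d ?N \<bullet> (matQ P ?N *\<^sub>v d ?N)))" for t
  proof -
    have "(\<Sum>i<?N. stage_cost P i (x i + t \<cdot>\<^sub>v d i) (u i + t \<cdot>\<^sub>v w i))
        = (\<Sum>i<?N. stage_cost P i (x i) (u i) + t * (grad_x P x u i \<bullet> d i + grad_u P x u i \<bullet> w i) + t\<^sup>2 * q i)"
      by (intro sum.cong refl q) simp
    also have "\<dots> = (\<Sum>i<?N. stage_cost P i (x i) (u i))
        + t * (\<Sum>i<?N. grad_x P x u i \<bullet> d i + grad_u P x u i \<bullet> w i) + t\<^sup>2 * (\<Sum>i<?N. q i)"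
      by (simp add: sum.distrib flip: sum_distrib_left)
    finally show ?thesis
      unfolding lqr_cost_def Q by (simp add: scalar_prod_linear distrib_left)
  qed
  then show ?thesis by blast
qed

text \<open>All constraints are affine, so moving along \<open>d\<close> and \<open>w\<close> stays
  feasible for every real step of either sign. A quadratic in the step that is minimal at 0 has no
  linear part.\<close>

lemma lqr_minimizer_variation:
  assumes P: "lqr_problem P" and m: "lqr_minimizer P x u"
    and d: "d 0 = 0\<^sub>v (sdim P 0)" "\<And>i. i \<le> hor P \<Longrightarrow> dim_vec (d i) = sdim P i"
      "\<And>i. i \<le> hor P \<Longrightarrow> matE P i *\<^sub>v d i = 0\<^sub>v (edim P i)"
    and w: "\<And>i. i < hor P \<Longrightarrow> dim_vec (w i) = udim P i"
      "\<And>i. i < hor P \<Longrightarrow> d (Suc i) = matA P i *\<^sub>v d i + matB P i *\<^sub>v w i"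
      "\<And>i. i < hor P \<Longrightarrow> matC P i *\<^sub>v d i + matD P i *\<^sub>v w i = 0\<^sub>v (cdim P i)"
  shows "(\<Sum>i<hor P. grad_x P x u i \<bullet> d i + grad_u P x u i \<bullet> w i) + grad_end P x \<bullet> d (hor P) = 0"
proof -
  have feas: "lqr_feasible P x u" using m by (simp add: lqr_minimizer_def)
  have x0: "x 0 = init P" and xd: "\<And>i. i \<le> hor P \<Longrightarrow> dim_vec (x i) = sdim P i"
    and xE: "\<And>i. i \<le> hor P \<Longrightarrow> matE P i *\<^sub>v x i + vece P i = 0\<^sub>v (edim P i)"
    and ud: "\<And>i. i < hor P \<Longrightarrow> dim_vec (u i) = udim P i"
    and dyn: "\<And>i. i < hor P \<Longrightarrow> x (Suc i) = matA P i *\<^sub>v x i + matB P i *\<^sub>v u i + vecc P i"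
    and mix: "\<And>i. i < hor P \<Longrightarrow> matC P i *\<^sub>v x i + matD P i *\<^sub>v u i + vecd P i = 0\<^sub>v (cdim P i)"
    using feas by (simp_all add: lqr_feasible_def suffix_feasible_def state_constraint_def)
  note [simp] = lqr_problemD[OF P] xd ud d(2) w(1)
  have feasible: "lqr_feasible P (\<lambda>i. x i + t \<cdot>\<^sub>v d i) (\<lambda>i. u i + t \<cdot>\<^sub>v w i)" for t
    unfolding lqr_feasible_def suffix_feasible_def state_constraint_def
  proof (intro conjI ballI)
    show "x 0 + t \<cdot>\<^sub>v d 0 = init P" unfolding d(1) x0 by (intro eq_vecI) simp_all
  next
    fix i assume "i \<in> {0..hor P}"
    then have [simp]: "i \<le> hor P" by simp
    show "x i + t \<cdot>\<^sub>v d i \<in> carrier_vec (sdim P i)" by simp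
    have "matE P i *\<^sub>v (x i + t \<cdot>\<^sub>v d i) + vece P i = (matE P i *\<^sub>v x i + vece P i) + t \<cdot>\<^sub>v (matE P i *\<^sub>v d i)"
      by (intro eq_vecI) (simp_all add: mult_mat_vec_linear del: index_mult_mat_vec)
    also have "\<dots> = 0\<^sub>v (edim P i)" by (simp only: xE d(3) \<open>i \<le> hor P\<close>) (intro eq_vecI; simp)
    finally show "matE P i *\<^sub>v (x i + t \<cdot>\<^sub>v d i) + vece P i = 0\<^sub>v (edim P i)" .
  next
    fix i assume "i \<in> {0..<hor P}"
    then have i [simp]: "i < hor P" "i \<le> hor P" by simp_all
    show "u i + t \<cdot>\<^sub>v w i \<in> carrier_vec (udim P i)" by simp
    show "x (Suc i) + t \<cdot>\<^sub>v d (Suc i) = matA P i *\<^sub>v (x i + t \<cdot>\<^sub>v d i) + matB P i *\<^sub>v (u i + t \<cdot>\<^sub>v w i) + vecc P i"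
      unfolding dyn[OF i(1)] w(2)[OF i(1)]
      by (intro eq_vecI) (simp_all add: mult_mat_vec_linear algebra_simps del: index_mult_mat_vec)
    have "matC P i *\<^sub>v (x i + t \<cdot>\<^sub>v d i) + matD P i *\<^sub>v (u i + t \<cdot>\<^sub>v w i) + vecd P i
        = (matC P i *\<^sub>v x i + matD P i *\<^sub>v u i + vecd P i) + t \<cdot>\<^sub>v (matC P i *\<^sub>v d i + matD P i *\<^sub>v w i)"
      by (intro eq_vecI) (simp_all add: mult_mat_vec_linear algebra_simps del: index_mult_mat_vec)
    also have "\<dots> = 0\<^sub>v (cdim P i)" unfolding mix[OF i(1)] w(3)[OF i(1)] by (intro eq_vecI) simp_all
    finally show "matC P i *\<^sub>v (x i + t \<cdot>\<^sub>v d i) + matD P i *\<^sub>v (u i + t \<cdot>\<^sub>v w i) + vecd P i = 0\<^sub>v (cdim P i)" .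
  qed
  obtain q where q: "\<And>t. lqr_cost P (\<lambda>i. x i + t \<cdot>\<^sub>v d i) (\<lambda>i. u i + t \<cdot>\<^sub>v w i) = lqr_cost P x u
    + t * ((\<Sum>i<hor P. grad_x P x u i \<bullet> d i + grad_u P x u i \<bullet> w i) + grad_end P x \<bullet> d (hor P)) + t\<^sup>2 * q"
    using lqr_cost_variation[OF P xd ud d(2) w(1)] by blast
  have "lqr_cost P x u \<le> lqr_cost P (\<lambda>i. x i + t \<cdot>\<^sub>v d i) (\<lambda>i. u i + t \<cdot>\<^sub>v w i)" for t
    using m feasible unfolding lqr_minimizer_def by blast
  then show ?thesis unfolding q by (intro quadratic_nonneg_linear_coeff_zero[where q = q]) (simp add: algebra_simps)
qed

lemma backward_recursion:
  fixes f :: "nat \<Rightarrow> 'a \<Rightarrow> 'a"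
  shows "\<exists>\<zeta>. \<zeta> N = e \<and> (\<forall>i<N. \<zeta> i = f i (\<zeta> (Suc i)))"
proof -
  \<comment> \<open>Time is reversed: \<open>g k\<close> is the value k steps before the
    end.\<close>
  define g where "g = rec_nat e (\<lambda>k. f (N - Suc k))"
  have "g (N - i) = f i (g (N - Suc i))" if "i < N" for i
  proof -
    have "N - i = Suc (N - Suc i)" "N - Suc (N - Suc i) = i" using that by simp_all
    then show ?thesis by (simp add: g_def)
  qed
  then show ?thesis by (intro exI[of _ "\<lambda>i. g (N - i)"]) (simp add: g_def)
qed

text \<open>The adjoint recursion can be solved backward for any trajectory; optimality is needed
  for control stationarity. Using the stationarity residual itself as control variation makes the
  directional derivative a sum of squares.\<close>

lemma unconstrained_adjoint:
  assumes P: "lqr_problem P" and m: "lqr_minimizer P x u"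
    and unc: "\<And>i. i \<le> hor P \<Longrightarrow> edim P i = 0" "\<And>i. i < hor P \<Longrightarrow> cdim P i = 0"
  shows "\<exists>\<zeta>. (\<forall>i\<le>hor P. dim_vec (\<zeta> i) = sdim P i) \<and> \<zeta> (hor P) = grad_end P x \<and>
    (\<forall>i<hor P. \<zeta> i = grad_x P x u i + (matA P i)\<^sup>T *\<^sub>v \<zeta> (Suc i) \<and>
      grad_u P x u i + (matB P i)\<^sup>T *\<^sub>v \<zeta> (Suc i) = 0\<^sub>v (udim P i))"
proof -
  obtain \<zeta> where \<zeta>N: "\<zeta> (hor P) = grad_end P x"
    and \<zeta>: "\<And>i. i < hor P \<Longrightarrow> \<zeta> i = grad_x P x u i + (matA P i)\<^sup>T *\<^sub>v \<zeta> (Suc i)"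
    using backward_recursion[of "hor P" "grad_end P x" "\<lambda>i l. grad_x P x u i + (matA P i)\<^sup>T *\<^sub>v l"]
    by blast
  have xd: "\<And>i. i \<le> hor P \<Longrightarrow> dim_vec (x i) = sdim P i" and ud: "\<And>i. i < hor P \<Longrightarrow> dim_vec (u i) = udim P i"
    using m by (simp_all add: lqr_minimizer_def lqr_feasible_def suffix_feasible_def)
  note [simp] = lqr_problemD[OF P] xd ud
  have \<zeta>d [simp]: "dim_vec (\<zeta> i) = sdim P i" if "i \<le> hor P" for i
    using that \<zeta>[of i] by (cases "i = hor P") (simp_all add: \<zeta>N)
  define w where "w i = grad_u P x u i + (matB P i)\<^sup>T *\<^sub>v \<zeta> (Suc i)" for i
  define d where "d = rec_nat (0\<^sub>v (sdim P 0)) (\<lambda>i d. matA P i *\<^sub>v d + matB P i *\<^sub>v w i)"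
  have d0: "d 0 = 0\<^sub>v (sdim P 0)" and dS: "d (Suc i) = matA P i *\<^sub>v d i + matB P i *\<^sub>v w i" for i
    by (simp_all add: d_def)
  have dd [simp]: "dim_vec (d i) = sdim P i" if "i \<le> hor P" for i
    using that by (cases i) (simp_all add: d0 dS)
  have wd [simp]: "dim_vec (w i) = udim P i" if "i < hor P" for i
    using that by (simp add: w_def)
  have total: "(\<Sum>i<hor P. grad_x P x u i \<bullet> d i + grad_u P x u i \<bullet> w i) + grad_end P x \<bullet> d (hor P) = 0"
  proof (rule lqr_minimizer_variation[OF P m d0 dd _ wd dS])
    show "matE P i *\<^sub>v d i = 0\<^sub>v (edim P i)" if "i \<le> hor P" for i
      using that unc by (intro eq_vecI) simp_all
    show "matC P i *\<^sub>v d i + matD P i *\<^sub>v w i = 0\<^sub>v (cdim P i)" if "i < hor P" for i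
      using that unc by (intro eq_vecI) simp_all
  qed
  \<comment> \<open>By the adjoint recursion and the linear dynamics of \<open>d\<close>, all terms
    except the square telescope.\<close>
  have "grad_x P x u i \<bullet> d i + grad_u P x u i \<bullet> w i
      = w i \<bullet> w i + \<zeta> i \<bullet> d i - \<zeta> (Suc i) \<bullet> d (Suc i)" if i [simp]: "i < hor P" for i
  proof -
    have [simp]: "i \<le> hor P" "Suc i \<le> hor P"
      by (rule less_imp_le[OF i], rule Suc_leI[OF i])
    have "w i \<bullet> w i = grad_u P x u i \<bullet> w i + \<zeta> (Suc i) \<bullet> (matB P i *\<^sub>v w i)"
      by (subst w_def) (simp add: scalar_prod_linear scalar_prod_transpose)
    moreover have "\<zeta> i \<bullet> d i = grad_x P x u i \<bullet> d i + \<zeta> (Suc i) \<bullet> (matA P i *\<^sub>v d i)"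
      unfolding \<zeta>[OF i] by (simp add: scalar_prod_linear scalar_prod_transpose)
    moreover have "\<zeta> (Suc i) \<bullet> d (Suc i) = \<zeta> (Suc i) \<bullet> (matA P i *\<^sub>v d i) + \<zeta> (Suc i) \<bullet> (matB P i *\<^sub>v w i)"
      unfolding dS by (simp add: scalar_prod_linear)
    ultimately show ?thesis by simp
  qed
  then have "(\<Sum>i<hor P. grad_x P x u i \<bullet> d i + grad_u P x u i \<bullet> w i)
      = (\<Sum>i<hor P. w i \<bullet> w i + \<zeta> i \<bullet> d i - \<zeta> (Suc i) \<bullet> d (Suc i))"
    by (intro sum.cong refl) simp
  also have "(\<Sum>i<n. w i \<bullet> w i + \<zeta> i \<bullet> d i - \<zeta> (Suc i) \<bullet> d (Suc i))
      = (\<Sum>i<n. w i \<bullet> w i) + \<zeta> 0 \<bullet> d 0 - \<zeta> n \<bullet> d n" for n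
    by (induction n) simp_all
  finally have "(\<Sum>i<hor P. w i \<bullet> w i) = \<zeta> (hor P) \<bullet> d (hor P) - \<zeta> 0 \<bullet> d 0 - grad_end P x \<bullet> d (hor P)"
    using total by linarith
  \<comment> \<open>The other boundary term cancels with the terminal gradient by the choice of
    \<open>\<zeta>\<close> at the horizon.\<close>
  moreover have "\<zeta> 0 \<bullet> d 0 = 0" by (simp add: d0)
  ultimately have "(\<Sum>i<hor P. w i \<bullet> w i) = 0" by (simp only: \<zeta>N)
  then have "w i \<bullet> w i = 0" if "i < hor P" for i
    using that by (subst (asm) sum_nonneg_eq_0_iff) (auto simp: scalar_prod_def intro!: sum_nonneg)
  then have "w i = 0\<^sub>v (udim P i)" if "i < hor P" for i
    using that conjugate_square_eq_0_vec[of "w i" "udim P i"] by simp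
  then have opt: "grad_u P x u i + (matB P i)\<^sup>T *\<^sub>v \<zeta> (Suc i) = 0\<^sub>v (udim P i)" if "i < hor P" for i
    using that unfolding w_def by blast
  show ?thesis using \<zeta>d \<zeta>N \<zeta> opt by blast
qed

section \<open>State and control parametrization\<close>

lemma affine_kernel_diff:
  fixes H :: "real mat"
  assumes "H *\<^sub>v a + h = 0\<^sub>v n" "H *\<^sub>v b + h = 0\<^sub>v n"
    "dim_vec a = dim_col H" "dim_vec b = dim_col H" "dim_vec h = n" "dim_row H = n"
  shows "H *\<^sub>v (a - b) = 0\<^sub>v n"
proof -
  have "H *\<^sub>v (a - b) = (H *\<^sub>v a + h) - (H *\<^sub>v b + h)"
    using assms(3-) by (intro eq_vecI) (simp_all add: mult_mat_vec_linear del: index_mult_mat_vec)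
  then show ?thesis unfolding assms(1,2) by (simp only:) (intro eq_vecI; simp)
qed

text \<open>Passes from the span of a set inside the kernel to the span in the full space, then to
  combinations of the list of columns, which are products of \<open>T\<close> with coordinate
  vectors.\<close>

lemma columns_basis_kernel_range:
  assumes "columns_basis_kernel T H"
  shows "mat_kernel H = {T *\<^sub>v z | z. z \<in> carrier_vec (dim_col T)}"
proof -
  interpret kernel "dim_row H" "dim_col H" H by unfold_locales simp
  have T: "dim_row T = dim_col H" and basis: "basis (set (cols T))"
    using assms by (simp_all add: columns_basis_kernel_def)
  then have sub: "set (cols T) \<subseteq> mat_kernel H" and gen: "span (set (cols T)) = mat_kernel H"
    by (simp_all add: Ker.basis_def)
  have c: "set (cols T) \<subseteq> carrier_vec (dim_col H)" using T cols_dim by metis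
  have "mat_kernel H = NC.span (set (cols T))" using span_same[OF sub] gen by simp
  also have "\<dots> = NC.span_list (cols T)" using NC.span_list_as_span[OF c] by simp
  also have "\<dots> = {T *\<^sub>v vec (dim_col T) c | c. True}"
    using NC.lincomb_list_as_mat_mult[of "cols T"] c T mat_of_cols_cols[of T]
    by (simp add: NC.span_list_def subset_iff)
  also have "\<dots> = {T *\<^sub>v z | z. z \<in> carrier_vec (dim_col T)}"
  proof (intro equalityI subsetI)
    fix v assume "v \<in> {T *\<^sub>v z | z. z \<in> carrier_vec (dim_col T)}"
    then obtain z where "dim_vec z = dim_col T" "v = T *\<^sub>v z" by auto
    moreover have "vec (dim_col T) (($) z) = z" using calculation by (intro eq_vecI) simp_all
    ultimately show "v \<in> {T *\<^sub>v vec (dim_col T) c | c. True}"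
      by (intro CollectI exI[of _ "($) z"]) simp
  next
    fix v assume "v \<in> {T *\<^sub>v vec (dim_col T) c | c. True}"
    then show "v \<in> {T *\<^sub>v z | z. z \<in> carrier_vec (dim_col T)}" by auto
  qed
  finally show ?thesis .
qed

locale parametrized_lqr =
  fixes P :: lqr and K :: param
  assumes problem: "lqr_problem P" and param: "valid_param P K"
begin

lemmas problem_dims [simp] = lqr_problemD[OF problem]

lemma state_param_dims [simp]:
  assumes "i \<le> hor P"
  shows "dim_col (matH K i) = sdim P i" "dim_vec (vech K i) = dim_row (matH K i)"
    "dim_vec (vect K i) = sdim P i" "dim_row (matT K i) = sdim P i"
    "dim_row (matS K i) = zdim K i" "dim_col (matS K i) = sdim P i"
  using param assms by (auto simp: valid_param_def columns_basis_kernel_def)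

lemma control_param_dims [simp]:
  assumes "i < hor P"
  shows "dim_row (matY K i) = udim P i" "dim_col (matY K i) = zdim K i"
    "dim_vec (vecy K i) = udim P i" "dim_row (matZ K i) = udim P i"
proof -
  show "dim_row (matY K i) = udim P i" "dim_col (matY K i) = zdim K i" "dim_vec (vecy K i) = udim P i"
    using param assms by (simp_all add: valid_param_def)
  have "dim_row (matZ K i) = dim_col (Gam P K i)"
    using param assms by (simp add: valid_param_def columns_basis_kernel_def)
  then show "dim_row (matZ K i) = udim P i" using assms by (simp add: Gam_def append_rows_def)
qed

lemma left_inverse:
  assumes "i \<le> hor P" "dim_vec z = zdim K i"
  shows "matS K i *\<^sub>v (matT K i *\<^sub>v z) = z"
proof -
  have "matS K i * matT K i = 1\<^sub>m (zdim K i)" using param assms by (simp add: valid_param_def)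
  then have "(matS K i * matT K i) *\<^sub>v z = z" using assms by simp
  then show ?thesis using assms by (simp add: mult_mat_mult_vec)
qed

text \<open>On the kernel of \<open>matH K i\<close> the left inverse \<open>matS K i\<close> is
  also a right inverse, because every kernel vector is already an image under
  \<open>matT K i\<close>.\<close>

lemma kernel_param:
  assumes "i \<le> hor P"
  shows "dim_vec z = zdim K i \<Longrightarrow> matH K i *\<^sub>v (matT K i *\<^sub>v z) = 0\<^sub>v (dim_row (matH K i))"
    and "dim_vec \<xi> = sdim P i \<Longrightarrow> matH K i *\<^sub>v \<xi> = 0\<^sub>v (dim_row (matH K i)) \<Longrightarrow>
      matT K i *\<^sub>v (matS K i *\<^sub>v \<xi>) = \<xi>"
proof -
  have "columns_basis_kernel (matT K i) (matH K i)" using param assms by (simp add: valid_param_def)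
  from columns_basis_kernel_range[OF this]
  have ker: "mat_kernel (matH K i) = {matT K i *\<^sub>v z | z. z \<in> carrier_vec (zdim K i)}" .
  show "matH K i *\<^sub>v (matT K i *\<^sub>v z) = 0\<^sub>v (dim_row (matH K i))" if "dim_vec z = zdim K i"
  proof -
    have "matT K i *\<^sub>v z \<in> mat_kernel (matH K i)" unfolding ker using that by auto
    then show ?thesis by (simp add: mat_kernel_def)
  qed
  show "matT K i *\<^sub>v (matS K i *\<^sub>v \<xi>) = \<xi>"
    if "dim_vec \<xi> = sdim P i" "matH K i *\<^sub>v \<xi> = 0\<^sub>v (dim_row (matH K i))"
  proof -
    have "\<xi> \<in> mat_kernel (matH K i)" using that assms by (simp add: mat_kernel_def)
    then obtain z where "dim_vec z = zdim K i" "\<xi> = matT K i *\<^sub>v z" unfolding ker by auto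
    then show ?thesis using left_inverse[OF assms] by simp
  qed
qed

lemma suffix_domain_iff:
  assumes "i \<le> hor P"
  shows "\<xi> \<in> suffix_domain P i \<longleftrightarrow>
    dim_vec \<xi> = sdim P i \<and> matH K i *\<^sub>v \<xi> + vech K i = 0\<^sub>v (dim_row (matH K i))"
proof -
  have "suffix_domain P i =
      {\<xi> \<in> carrier_vec (sdim P i). matH K i *\<^sub>v \<xi> + vech K i = 0\<^sub>v (dim_row (matH K i))}"
    using param assms by (simp add: valid_param_def)
  then show ?thesis by simp
qed

lemma base_point:
  assumes "i \<le> hor P"
  shows "matH K i *\<^sub>v vect K i + vech K i = 0\<^sub>v (dim_row (matH K i))"
  using param assms by (simp add: valid_param_def)

lemma suffix_domain_param:
  assumes i: "i \<le> hor P" and z: "dim_vec z = zdim K i"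
  shows "matT K i *\<^sub>v z + vect K i \<in> suffix_domain P i"
proof -
  note [simp] = i z
  have "matH K i *\<^sub>v (matT K i *\<^sub>v z + vect K i) + vech K i
      = matH K i *\<^sub>v (matT K i *\<^sub>v z) + (matH K i *\<^sub>v vect K i + vech K i)"
    by (intro eq_vecI) (simp_all add: mult_mat_vec_linear del: index_mult_mat_vec)
  also have "\<dots> = 0\<^sub>v (dim_row (matH K i))"
    unfolding base_point[OF i] kernel_param(1)[OF i z] by (intro eq_vecI) simp_all
  finally show ?thesis by (simp add: suffix_domain_iff)
qed

text \<open>The choice of left inverse is harmless, since \<open>\<xi> - vect K i\<close> lies in
  the kernel of \<open>matH K i\<close>.\<close>

lemma suffix_domain_coordinates:
  assumes i: "i \<le> hor P" and \<xi>: "\<xi> \<in> suffix_domain P i"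
  shows "matT K i *\<^sub>v (matS K i *\<^sub>v (\<xi> - vect K i)) + vect K i = \<xi>"
proof -
  note [simp] = i
  have d [simp]: "dim_vec \<xi> = sdim P i" using \<xi> by (simp add: suffix_domain_iff)
  have "matH K i *\<^sub>v (\<xi> - vect K i) = 0\<^sub>v (dim_row (matH K i))"
    by (rule affine_kernel_diff[where h = "vech K i"]) (use \<xi> in \<open>simp_all add: suffix_domain_iff base_point\<close>)
  then have "matT K i *\<^sub>v (matS K i *\<^sub>v (\<xi> - vect K i)) = \<xi> - vect K i"
    by (intro kernel_param(2)) simp_all
  then show ?thesis by (simp only:) (intro eq_vecI; simp)
qed

lemma suffix_domain_hor:
  "\<xi> \<in> suffix_domain P (hor P) \<longleftrightarrow> dim_vec \<xi> = sdim P (hor P) \<and> state_constraint P (hor P) \<xi>"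
proof
  assume "dim_vec \<xi> = sdim P (hor P) \<and> state_constraint P (hor P) \<xi>"
  then show "\<xi> \<in> suffix_domain P (hor P)"
    unfolding suffix_domain_def suffix_feasible_def
    by (intro CollectI exI[of _ "\<lambda>_. \<xi>"]) auto
qed (auto simp: suffix_domain_def suffix_feasible_def)

text \<open>The dynamic programming recursion for domains: a feasible tail is one feasible control
  followed by a feasible tail from the successor.\<close>

lemma suffix_domain_step:
  assumes "i < hor P"
  shows "\<xi> \<in> suffix_domain P i \<longleftrightarrow> dim_vec \<xi> = sdim P i \<and> state_constraint P i \<xi> \<and>
    (\<exists>\<omega>. dim_vec \<omega> = udim P i \<and> matC P i *\<^sub>v \<xi> + matD P i *\<^sub>v \<omega> + vecd P i = 0\<^sub>v (cdim P i) \<and>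
      matA P i *\<^sub>v \<xi> + matB P i *\<^sub>v \<omega> + vecc P i \<in> suffix_domain P (Suc i))" (is "_ \<longleftrightarrow> ?R")
proof
  assume "\<xi> \<in> suffix_domain P i"
  then obtain x u where x: "x i = \<xi>" and f: "suffix_feasible P i x u" by (auto simp: suffix_domain_def)
  then have "suffix_feasible P (Suc i) x u" by (simp add: suffix_feasible_def)
  then have "x (Suc i) \<in> suffix_domain P (Suc i)" by (auto simp: suffix_domain_def)
  moreover have "x (Suc i) = matA P i *\<^sub>v \<xi> + matB P i *\<^sub>v u i + vecc P i"
    and "matC P i *\<^sub>v \<xi> + matD P i *\<^sub>v u i + vecd P i = 0\<^sub>v (cdim P i)"
    and "dim_vec \<xi> = sdim P i" "state_constraint P i \<xi>" "dim_vec (u i) = udim P i"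
    using f assms unfolding suffix_feasible_def x[symmetric] by simp_all
  ultimately show ?R by (metis (no_types))
next
  assume R: ?R
  then obtain \<omega> where \<omega>: "dim_vec \<omega> = udim P i"
    "matC P i *\<^sub>v \<xi> + matD P i *\<^sub>v \<omega> + vecd P i = 0\<^sub>v (cdim P i)"
    "matA P i *\<^sub>v \<xi> + matB P i *\<^sub>v \<omega> + vecc P i \<in> suffix_domain P (Suc i)" by blast
  then obtain x u where x: "x (Suc i) = matA P i *\<^sub>v \<xi> + matB P i *\<^sub>v \<omega> + vecc P i"
    and f: "suffix_feasible P (Suc i) x u" by (auto simp: suffix_domain_def)
  \<comment> \<open>Constraints from \<open>Suc i\<close> on do not mention index \<open>i\<close>,
    so the overwriting leaves the tail feasible.\<close>
  have "suffix_feasible P i (x(i := \<xi>)) (u(i := \<omega>))"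
    unfolding suffix_feasible_def
  proof (intro conjI ballI)
    fix k assume "k \<in> {i..hor P}"
    then show "(x(i := \<xi>)) k \<in> carrier_vec (sdim P k)" "state_constraint P k ((x(i := \<xi>)) k)"
      using R f by (cases "k = i"; simp add: suffix_feasible_def)+
  next
    fix k assume k: "k \<in> {i..<hor P}"
    show "(u(i := \<omega>)) k \<in> carrier_vec (udim P k)"
      "(x(i := \<xi>)) (Suc k) = matA P k *\<^sub>v (x(i := \<xi>)) k + matB P k *\<^sub>v (u(i := \<omega>)) k + vecc P k"
      "matC P k *\<^sub>v (x(i := \<xi>)) k + matD P k *\<^sub>v (u(i := \<omega>)) k + vecd P k = 0\<^sub>v (cdim P k)"
      using \<omega> x f k by (cases "k = i"; simp add: suffix_feasible_def)+
  qed
  then show "\<xi> \<in> suffix_domain P i" unfolding suffix_domain_def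
    by (intro CollectI exI[of _ "x(i := \<xi>)"] exI[of _ "u(i := \<omega>)"]) simp
qed

text \<open>Explains the stacked system: the first block is the mixed constraint, the second puts
  the successor into the next suffix domain. Its solutions are thus the controls from which the tail
  can still be completed.\<close>

lemma control_param_iff:
  assumes i: "i < hor P" and z: "dim_vec z = zdim K i" and \<omega>: "dim_vec \<omega> = udim P i"
  defines "\<xi> \<equiv> matT K i *\<^sub>v z + vect K i"
  shows "matC P i *\<^sub>v \<xi> + matD P i *\<^sub>v \<omega> + vecd P i = 0\<^sub>v (cdim P i) \<and>
      matA P i *\<^sub>v \<xi> + matB P i *\<^sub>v \<omega> + vecc P i \<in> suffix_domain P (Suc i) \<longleftrightarrow>
    (\<exists>v. dim_vec v = vdim K i \<and> \<omega> = matY K i *\<^sub>v z + matZ K i *\<^sub>v v + vecy K i)"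
proof -
  note [simp] = i z \<omega> less_imp_le[OF i] Suc_leI[OF i]
  let ?H = "matH K (Suc i)"
  have gam: "Gam P K i *\<^sub>v \<omega> + Phi P K i *\<^sub>v z + gam P K i =
      (matC P i *\<^sub>v \<xi> + matD P i *\<^sub>v \<omega> + vecd P i)
      @\<^sub>v (?H *\<^sub>v (matA P i *\<^sub>v \<xi> + matB P i *\<^sub>v \<omega> + vecc P i) + vech K (Suc i))"
    unfolding Gam_def Phi_def gam_def \<xi>_def
    by (simp add: append_rows_mult_vec append_vec_combination append_vec_eq_iff, intro conjI eq_vecI)
       (simp_all add: mult_mat_vec_linear del: index_mult_mat_vec)
  have "dim_row (Gam P K i) = cdim P i + dim_row ?H" by (simp add: Gam_def append_rows_def)
  moreover have "0\<^sub>v (cdim P i + dim_row ?H) = (0\<^sub>v (cdim P i) @\<^sub>v 0\<^sub>v (dim_row ?H) :: real vec)"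
    by (intro eq_vecI) simp_all
  ultimately have "Gam P K i *\<^sub>v \<omega> + Phi P K i *\<^sub>v z + gam P K i = 0\<^sub>v (dim_row (Gam P K i)) \<longleftrightarrow>
    matC P i *\<^sub>v \<xi> + matD P i *\<^sub>v \<omega> + vecd P i = 0\<^sub>v (cdim P i) \<and>
      matA P i *\<^sub>v \<xi> + matB P i *\<^sub>v \<omega> + vecc P i \<in> suffix_domain P (Suc i)"
    unfolding gam by (simp add: append_vec_eq_iff suffix_domain_iff)
  moreover have "{u \<in> carrier_vec (udim P i).
              Gam P K i *\<^sub>v u + Phi P K i *\<^sub>v z + gam P K i = 0\<^sub>v (dim_row (Gam P K i))} =
           {matY K i *\<^sub>v z + matZ K i *\<^sub>v v + vecy K i | v. v \<in> carrier_vec (vdim K i)}"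
    using param i z unfolding valid_param_def by simp
  from this[THEN eqset_imp_iff, of \<omega>]
  have "Gam P K i *\<^sub>v \<omega> + Phi P K i *\<^sub>v z + gam P K i = 0\<^sub>v (dim_row (Gam P K i)) \<longleftrightarrow>
    (\<exists>v. dim_vec v = vdim K i \<and> \<omega> = matY K i *\<^sub>v z + matZ K i *\<^sub>v v + vecy K i)"
    by auto
  ultimately show ?thesis by simp
qed

end

section \<open>The reduced problem\<close>

lemma transpose_mat_mult:
  assumes "dim_col A = dim_row B"
  shows "(A * B)\<^sup>T = B\<^sup>T * (A\<^sup>T :: real mat)"
  using assms by (intro transpose_mult[of _ "dim_row A" "dim_col A" _ "dim_col B"]) simp_all

lemma transpose_mat_add:
  assumes "dim_row A = dim_row B" "dim_col A = dim_col B"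
  shows "(A + B)\<^sup>T = A\<^sup>T + (B\<^sup>T :: real mat)"
  using assms by (intro transpose_add[of _ "dim_row A" "dim_col A"]) simp_all

lemma transpose_congruence:
  assumes "Q\<^sup>T = Q" "dim_row Q = n" "dim_col Q = n" "dim_row T = n"
  shows "(T\<^sup>T * Q * T)\<^sup>T = T\<^sup>T * Q * (T :: real mat)"
proof -
  have "(T\<^sup>T * Q * T)\<^sup>T = T\<^sup>T * (Q * T)"
    using assms by (simp add: transpose_mat_mult)
  also have "\<dots> = T\<^sup>T * Q * T"
    using assms by (intro assoc_mult_mat[symmetric, of _ "dim_col T" n _ n _ "dim_col T"]) simp_all
  finally show ?thesis .
qed

context parametrized_lqr
begin

lemma reduced_simps [simp]:
  "hor (reduced_lqr P K) = hor P" "sdim (reduced_lqr P K) = zdim K" "udim (reduced_lqr P K) = vdim K"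
  "cdim (reduced_lqr P K) i = 0" "edim (reduced_lqr P K) i = 0"
  "init (reduced_lqr P K) = matS K 0 *\<^sub>v (init P - vect K 0)"
  "matA (reduced_lqr P K) i = matS K (Suc i) * (matA P i * matT K i + matB P i * matY K i)"
  "matB (reduced_lqr P K) i = matS K (Suc i) * matB P i * matZ K i"
  "vecc (reduced_lqr P K) i = matS K (Suc i) *\<^sub>v
     (matA P i *\<^sub>v vect K i + matB P i *\<^sub>v vecy K i + vecc P i - vect K (Suc i))"
  by (simp_all add: reduced_lqr_def)

text \<open>Needed to apply the first-order results to the reduced data. Only symmetry takes work:
  the two cross terms of the reduced \<open>matQ\<close> are transposes of each other.\<close>

lemma reduced_problem: "lqr_problem (reduced_lqr P K)"
proof -
  let ?R = "reduced_lqr P K"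
  have "(matQ ?R i)\<^sup>T = matQ ?R i" if i [simp]: "i \<le> hor P" for i
  proof -
    have Q: "(Qz P K i)\<^sup>T = Qz P K i"
      by (rule transpose_congruence[where n = "sdim P i"]) (simp_all add: lqr_problem_symmetric[OF problem])
    show ?thesis
    proof (cases "i < hor P")
      case True
      note [simp] = True
      have R: "((matY K i)\<^sup>T * matR P i * matY K i)\<^sup>T = (matY K i)\<^sup>T * matR P i * matY K i"
        by (rule transpose_congruence[where n = "udim P i"]) (simp_all add: lqr_problem_symmetric[OF problem])
      have M: "(Mz P K i * matY K i)\<^sup>T = (matY K i)\<^sup>T * (Mz P K i)\<^sup>T"
        "((matY K i)\<^sup>T * (Mz P K i)\<^sup>T)\<^sup>T = Mz P K i * matY K i"
        by (subst transpose_mat_mult; simp)+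
      have "(matQ ?R i)\<^sup>T = (Qz P K i)\<^sup>T + (Mz P K i * matY K i)\<^sup>T + ((matY K i)\<^sup>T * (Mz P K i)\<^sup>T)\<^sup>T
          + ((matY K i)\<^sup>T * matR P i * matY K i)\<^sup>T"
        by (simp add: reduced_lqr_def transpose_mat_add)
      also have "\<dots> = Qz P K i + (matY K i)\<^sup>T * (Mz P K i)\<^sup>T + Mz P K i * matY K i
          + (matY K i)\<^sup>T * matR P i * matY K i"
        unfolding Q R M ..
      also have "\<dots> = matQ ?R i"
        by (simp add: reduced_lqr_def) (intro eq_matI; simp)
      finally show ?thesis .
    qed (use Q in \<open>simp add: reduced_lqr_def\<close>)
  qed
  moreover have "(matR ?R i)\<^sup>T = matR ?R i" if "i < hor P" for i
    using that transpose_congruence[of "matR P i" "udim P i" "matZ K i"] lqr_problem_symmetric[OF problem]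
    by (simp add: reduced_lqr_def)
  ultimately show ?thesis
    using problem_dims(1) unfolding lqr_problem_def by (simp add: reduced_lqr_def)
qed

text \<open>The chain rule: up to a constant, the reduced cost is the original one composed with the
  affine recovery map, so gradients are pulled back by the transpose of its linear part.\<close>

lemma reduced_gradient:
  assumes i: "i < hor P" and z: "dim_vec (z i) = zdim K i" and v: "dim_vec (v i) = vdim K i"
  defines "x \<equiv> recover_x K z" and "u \<equiv> recover_u K z v"
  shows "grad_x (reduced_lqr P K) z v i = (matT K i)\<^sup>T *\<^sub>v grad_x P x u i + (matY K i)\<^sup>T *\<^sub>v grad_u P x u i"
    and "grad_u (reduced_lqr P K) z v i = (matZ K i)\<^sup>T *\<^sub>v grad_u P x u i"
proof -
  note [simp] = i z v less_imp_le[OF i]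
  have RT: "(matR P i)\<^sup>T = matR P i" using lqr_problem_symmetric[OF problem] by simp
  have MT: "(Mz P K i)\<^sup>T = (matM P i)\<^sup>T * matT K i" by (simp add: transpose_mat_mult)
  show "grad_x (reduced_lqr P K) z v i = (matT K i)\<^sup>T *\<^sub>v grad_x P x u i + (matY K i)\<^sup>T *\<^sub>v grad_u P x u i"
    unfolding x_def u_def recover_x_def recover_u_def
    by (intro eq_vecI) (simp_all add: reduced_lqr_def MT mult_mat_vec_linear del: index_mult_mat_vec)
  have "(Mz P K i * matZ K i + (matY K i)\<^sup>T * matR P i * matZ K i)\<^sup>T
      = (matZ K i)\<^sup>T * (Mz P K i)\<^sup>T + (matZ K i)\<^sup>T * (matR P i * matY K i)"
    by (subst transpose_add[of _ "zdim K i" "vdim K i"]) (simp_all add: transpose_mat_mult RT)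
  then show "grad_u (reduced_lqr P K) z v i = (matZ K i)\<^sup>T *\<^sub>v grad_u P x u i"
    unfolding x_def u_def recover_x_def recover_u_def
    by (intro eq_vecI) (simp_all add: reduced_lqr_def MT mult_mat_vec_linear del: index_mult_mat_vec)
qed

lemma reduced_end_gradient:
  assumes "dim_vec (z (hor P)) = zdim K (hor P)"
  shows "grad_end (reduced_lqr P K) z = (matT K (hor P))\<^sup>T *\<^sub>v grad_end P (recover_x K z)"
  using assms unfolding recover_x_def
  by (intro eq_vecI) (simp_all add: reduced_lqr_def mult_mat_vec_linear del: index_mult_mat_vec)

text \<open>Parametrized controls keep the successor in the next suffix domain. There the
  coordinates computed with \<open>matS\<close> determine the state, so the reduced dynamics
  reproduces the original one.\<close>

lemma recovered_feasible:
  assumes init: "matH K 0 *\<^sub>v init P + vech K 0 = 0\<^sub>v (dim_row (matH K 0))"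
    and f: "lqr_feasible (reduced_lqr P K) z v"
  defines "x \<equiv> recover_x K z" and "u \<equiv> recover_u K z v"
  shows "lqr_feasible P x u" "\<And>i. i \<le> hor P \<Longrightarrow> x i \<in> suffix_domain P i"
proof -
  have zd: "\<And>i. i \<le> hor P \<Longrightarrow> dim_vec (z i) = zdim K i" and vd: "\<And>i. i < hor P \<Longrightarrow> dim_vec (v i) = vdim K i"
    and z0: "z 0 = matS K 0 *\<^sub>v (init P - vect K 0)"
    and zS: "\<And>i. i < hor P \<Longrightarrow> z (Suc i) = matA (reduced_lqr P K) i *\<^sub>v z i + matB (reduced_lqr P K) i *\<^sub>v v i
        + vecc (reduced_lqr P K) i"
    using f by (simp_all add: lqr_feasible_def suffix_feasible_def del: reduced_simps(7-9))
  note [simp] = zd vd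
  show dom: "x i \<in> suffix_domain P i" if "i \<le> hor P" for i
    using that suffix_domain_param[of i "z i"] by (simp add: x_def recover_x_def)
  have ud [simp]: "dim_vec (u i) = udim P i" if "i < hor P" for i
    using that by (simp add: u_def recover_u_def)
  \<comment> \<open>The initial condition enters here: recovery returns \<open>init P\<close>
    because it lies in the first suffix domain.\<close>
  have "init P \<in> suffix_domain P 0" using init by (simp add: suffix_domain_iff)
  then have x0: "x 0 = init P"
    using suffix_domain_coordinates[of 0] by (simp add: x_def recover_x_def z0)
  have step: "matC P i *\<^sub>v x i + matD P i *\<^sub>v u i + vecd P i = 0\<^sub>v (cdim P i)"
    "x (Suc i) = matA P i *\<^sub>v x i + matB P i *\<^sub>v u i + vecc P i" if i [simp]: "i < hor P" for i
  proof -
    note [simp] = less_imp_le[OF i] Suc_leI[OF i]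
    let ?\<xi> = "matA P i *\<^sub>v x i + matB P i *\<^sub>v u i + vecc P i"
    have *: "matC P i *\<^sub>v x i + matD P i *\<^sub>v u i + vecd P i = 0\<^sub>v (cdim P i) \<and> ?\<xi> \<in> suffix_domain P (Suc i)"
      unfolding x_def recover_x_def
      by (subst control_param_iff) (auto simp: u_def recover_u_def intro!: exI[of _ "v i"])
    then show "matC P i *\<^sub>v x i + matD P i *\<^sub>v u i + vecd P i = 0\<^sub>v (cdim P i)" by blast
    have "z (Suc i) = matS K (Suc i) *\<^sub>v (?\<xi> - vect K (Suc i))"
      unfolding zS[OF i] reduced_simps x_def u_def recover_x_def recover_u_def
      by (intro eq_vecI) (simp_all add: mult_mat_vec_linear del: index_mult_mat_vec)
    then show "x (Suc i) = ?\<xi>"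
      using suffix_domain_coordinates[of "Suc i" ?\<xi>] * by (simp add: x_def recover_x_def)
  qed
  show "lqr_feasible P x u"
    unfolding lqr_feasible_def suffix_feasible_def
  proof (intro conjI ballI)
    fix i assume "i \<in> {0..hor P}"
    then have i: "i \<le> hor P" by simp
    then show "x i \<in> carrier_vec (sdim P i)" "state_constraint P i (x i)"
      using dom[OF i] suffix_domain_hor suffix_domain_step[of i] by (cases "i = hor P"; simp)+
  qed (use x0 step in simp_all)
qed

text \<open>Adding the direction to a parametrized feasible point gives another feasible point with
  successor in the next suffix domain. Differences of the two sets of coordinates are the
  coordinates of the direction.\<close>

lemma direction_param:
  fixes z v \<xi> \<omega> w :: "real vec"
  assumes i: "i < hor P" and z: "dim_vec z = zdim K i" and v: "dim_vec v = vdim K i"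
    and \<xi>: "dim_vec \<xi> = sdim P i" and \<omega>: "dim_vec \<omega> = udim P i" and w: "dim_vec w = zdim K (Suc i)"
    and E: "matE P i *\<^sub>v \<xi> = 0\<^sub>v (edim P i)"
    and C: "matC P i *\<^sub>v \<xi> + matD P i *\<^sub>v \<omega> = 0\<^sub>v (cdim P i)"
    and A: "matA P i *\<^sub>v \<xi> + matB P i *\<^sub>v \<omega> = matT K (Suc i) *\<^sub>v w"
  obtains s r where "dim_vec s = zdim K i" "dim_vec r = vdim K i" "\<xi> = matT K i *\<^sub>v s"
    "\<omega> = matY K i *\<^sub>v s + matZ K i *\<^sub>v r"
    "w = matA (reduced_lqr P K) i *\<^sub>v s + matB (reduced_lqr P K) i *\<^sub>v r"
proof -
  note [simp] = assms(1-6) less_imp_le[OF i] Suc_leI[OF i]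
  define x where "x = matT K i *\<^sub>v z + vect K i"
  define u where "u = matY K i *\<^sub>v z + matZ K i *\<^sub>v v + vecy K i"
  have xd [simp]: "dim_vec x = sdim P i" and ud [simp]: "dim_vec u = udim P i"
    by (simp_all add: x_def u_def)
  have dom: "x \<in> suffix_domain P i" unfolding x_def by (rule suffix_domain_param) simp_all
  have xu: "matC P i *\<^sub>v x + matD P i *\<^sub>v u + vecd P i = 0\<^sub>v (cdim P i)"
    "matA P i *\<^sub>v x + matB P i *\<^sub>v u + vecc P i \<in> suffix_domain P (Suc i)" (is "?x' \<in> _")
    using control_param_iff[OF i z ud, folded x_def] v unfolding u_def by blast+
  have E': "state_constraint P i (x + \<xi>)"
  proof -
    have "matE P i *\<^sub>v (x + \<xi>) + vece P i = (matE P i *\<^sub>v x + vece P i) + matE P i *\<^sub>v \<xi>"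
      by (intro eq_vecI) (simp_all add: mult_mat_vec_linear del: index_mult_mat_vec)
    also have "matE P i *\<^sub>v x + vece P i = 0\<^sub>v (edim P i)"
      using dom by (simp add: suffix_domain_step state_constraint_def)
    finally show ?thesis unfolding state_constraint_def E by (simp only:) (intro eq_vecI; simp)
  qed
  have C': "matC P i *\<^sub>v (x + \<xi>) + matD P i *\<^sub>v (u + \<omega>) + vecd P i = 0\<^sub>v (cdim P i)"
  proof -
    have "matC P i *\<^sub>v (x + \<xi>) + matD P i *\<^sub>v (u + \<omega>) + vecd P i
        = (matC P i *\<^sub>v x + matD P i *\<^sub>v u + vecd P i) + (matC P i *\<^sub>v \<xi> + matD P i *\<^sub>v \<omega>)"
      by (intro eq_vecI) (simp_all add: mult_mat_vec_linear del: index_mult_mat_vec)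
    then show ?thesis unfolding C xu(1) by (simp only:) (intro eq_vecI; simp)
  qed
  have A': "matA P i *\<^sub>v (x + \<xi>) + matB P i *\<^sub>v (u + \<omega>) + vecc P i \<in> suffix_domain P (Suc i)"
  proof -
    have "matA P i *\<^sub>v (x + \<xi>) + matB P i *\<^sub>v (u + \<omega>) + vecc P i
        = ?x' + (matA P i *\<^sub>v \<xi> + matB P i *\<^sub>v \<omega>)"
      by (intro eq_vecI) (simp_all add: mult_mat_vec_linear del: index_mult_mat_vec)
    also have "\<dots> = ?x' + matT K (Suc i) *\<^sub>v w" unfolding A ..
    \<comment> \<open>In the coordinates of the next suffix domain the successor is shifted by
      \<open>w\<close>, so it stays inside.\<close>
    also have "\<dots> = matT K (Suc i) *\<^sub>v (matS K (Suc i) *\<^sub>v (?x' - vect K (Suc i)) + w) + vect K (Suc i)"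
    proof -
      have "?x' + matT K (Suc i) *\<^sub>v w =
          (matT K (Suc i) *\<^sub>v (matS K (Suc i) *\<^sub>v (?x' - vect K (Suc i))) + vect K (Suc i)) + matT K (Suc i) *\<^sub>v w"
        by (subst suffix_domain_coordinates[OF _ xu(2)]) simp_all
      also have "\<dots> = matT K (Suc i) *\<^sub>v (matS K (Suc i) *\<^sub>v (?x' - vect K (Suc i)) + w) + vect K (Suc i)"
        by (subst mult_mat_vec_add; (simp; fail)?) (intro eq_vecI; simp del: index_mult_mat_vec)
      finally show ?thesis .
    qed
    finally show ?thesis by (simp only:) (rule suffix_domain_param; simp)
  qed
  have "x + \<xi> \<in> suffix_domain P i"
    using E' C' A' by (subst suffix_domain_step) (auto intro!: exI[of _ "u + \<omega>"])
  then have "matH K i *\<^sub>v ((x + \<xi>) - x) = 0\<^sub>v (dim_row (matH K i))"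
    using dom by (intro affine_kernel_diff[where h = "vech K i"]) (simp_all add: suffix_domain_iff)
  moreover have "(x + \<xi>) - x = \<xi>" by (intro eq_vecI) simp_all
  ultimately have H: "matH K i *\<^sub>v \<xi> = 0\<^sub>v (dim_row (matH K i))" by simp
  define s where "s = matS K i *\<^sub>v \<xi>"
  have sd [simp]: "dim_vec s = zdim K i" by (simp add: s_def)
  have \<xi>s: "\<xi> = matT K i *\<^sub>v s" unfolding s_def using kernel_param(2)[OF _ _ H] by simp
  have "x + \<xi> = matT K i *\<^sub>v (z + s) + vect K i"
    unfolding x_def \<xi>s by (intro eq_vecI) (simp_all add: mult_mat_vec_linear del: index_mult_mat_vec)
  then obtain v' where v' [simp]: "dim_vec v' = vdim K i"
    and u': "u + \<omega> = matY K i *\<^sub>v (z + s) + matZ K i *\<^sub>v v' + vecy K i"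
    using control_param_iff[of i "z + s" "u + \<omega>"] C' A' by auto
  define r where "r = v' - v"
  have rd [simp]: "dim_vec r = vdim K i" by (simp add: r_def)
  have "\<omega> = (u + \<omega>) - u" by (intro eq_vecI) simp_all
  also have "\<dots> = matY K i *\<^sub>v s + matZ K i *\<^sub>v r"
    unfolding u' unfolding u_def r_def
    by (intro eq_vecI) (simp_all add: mult_mat_vec_linear del: index_mult_mat_vec)
  finally have \<omega>s: "\<omega> = matY K i *\<^sub>v s + matZ K i *\<^sub>v r" .
  \<comment> \<open>The left inverse extracts \<open>w\<close> from the dynamics of the direction,
    which yields the reduced dynamics.\<close>
  have "w = matS K (Suc i) *\<^sub>v (matT K (Suc i) *\<^sub>v w)" by (simp add: left_inverse)
  also have "\<dots> = matA (reduced_lqr P K) i *\<^sub>v s + matB (reduced_lqr P K) i *\<^sub>v r"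
    unfolding A[symmetric] unfolding \<omega>s \<xi>s reduced_simps
    by (intro eq_vecI) (simp_all add: mult_mat_vec_linear del: index_mult_mat_vec)
  finally show ?thesis using that[OF sd rd \<xi>s \<omega>s] by blast
qed

end

section \<open>Existence of multipliers\<close>

lemma vec_eq_0_if_orthogonal:
  fixes a :: "real vec"
  assumes "\<And>l. dim_vec l = dim_vec a \<Longrightarrow> l \<bullet> a = 0"
  shows "a = 0\<^sub>v (dim_vec a)"
  using assms[of a] conjugate_square_eq_0_vec[of a "dim_vec a"] by simp

lemma vec_split_append:
  fixes y :: "real vec"
  assumes "dim_vec y = m + n"
  obtains a b where "dim_vec a = m" "dim_vec b = n" "y = a @\<^sub>v b"
proof -
  have "y = vec_first y m @\<^sub>v vec_last y n" using assms by simp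
  then show ?thesis by (rule that[rotated -1]) simp_all
qed

lemma scalar_prod_append_vec:
  fixes a :: "real vec"
  assumes "dim_vec a = dim_vec a'" "dim_vec b = dim_vec b'"
  shows "(a @\<^sub>v b) \<bullet> (a' @\<^sub>v b') = a \<bullet> a' + b \<bullet> b'"
  using assms by (intro scalar_prod_append[of _ "dim_vec a" _ "dim_vec b"]) simp_all

context parametrized_lqr
begin

text \<open>The invariant for the next stage is solved together with stationarity. A solution of
  stationarity alone could violate it and block the next stage.\<close>

lemma stage_multipliers_exist:
  fixes z v :: "nat \<Rightarrow> real vec"
  assumes i: "i < hor P" and z: "dim_vec (z i) = zdim K i" and v: "dim_vec (v i) = vdim K i"
    and l: "dim_vec l = sdim P i" and \<zeta>d: "dim_vec \<zeta>' = zdim K (Suc i)"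
  defines "x \<equiv> recover_x K z" and "u \<equiv> recover_u K z v"
  assumes \<zeta>: "(matT K i)\<^sup>T *\<^sub>v l = grad_x (reduced_lqr P K) z v i + (matA (reduced_lqr P K) i)\<^sup>T *\<^sub>v \<zeta>'"
    and opt: "grad_u (reduced_lqr P K) z v i + (matB (reduced_lqr P K) i)\<^sup>T *\<^sub>v \<zeta>' = 0\<^sub>v (vdim K i)"
  obtains l' \<mu> \<eta> where "dim_vec l' = sdim P (Suc i)" "stationary P x u i l l' \<mu> \<eta>"
    "(matT K (Suc i))\<^sup>T *\<^sub>v l' = \<zeta>'"
proof -
  note [simp] = i z v l \<zeta>d less_imp_le[OF i] Suc_leI[OF i]
  let ?A = "matA P i" and ?B = "matB P i" and ?C = "matC P i" and ?D = "matD P i" and ?E = "matE P i"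
    and ?T = "matT K i" and ?T' = "matT K (Suc i)" and ?A' = "matA (reduced_lqr P K) i"
    and ?B' = "matB (reduced_lqr P K) i"
  let ?n = "sdim P i" and ?m = "udim P i" and ?k = "zdim K (Suc i)"
  have [simp]: "dim_row ?A' = ?k" "dim_col ?A' = zdim K i" "dim_row ?B' = ?k" "dim_col ?B' = vdim K i"
    by simp_all
  define gx where "gx = grad_x P x u i"
  define gu where "gu = grad_u P x u i"
  have [simp]: "dim_vec (x i) = ?n" "dim_vec (u i) = ?m"
    by (simp_all add: x_def u_def recover_x_def recover_u_def)
  have [simp]: "dim_vec gx = ?n" "dim_vec gu = ?m" by (simp_all add: gx_def gu_def)
  have \<zeta>_eq: "?T\<^sup>T *\<^sub>v l = ?T\<^sup>T *\<^sub>v gx + (matY K i)\<^sup>T *\<^sub>v gu + ?A'\<^sup>T *\<^sub>v \<zeta>'"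
    unfolding \<zeta> gx_def gu_def x_def u_def by (subst reduced_gradient(1)) simp_all
  have opt_eq: "(matZ K i)\<^sup>T *\<^sub>v gu + ?B'\<^sup>T *\<^sub>v \<zeta>' = 0\<^sub>v (vdim K i)"
    using opt unfolding gu_def x_def u_def by (subst (asm) reduced_gradient(2)) simp_all
  \<comment> \<open>The blocks are state stationarity, control stationarity and the invariant at the
    next stage; a test vector splits accordingly into \<open>\<xi>\<close>, \<open>\<omega>\<close>
    and \<open>w\<close>.\<close>
  define F where "F l' \<mu> \<eta> = ((?A\<^sup>T *\<^sub>v l' + ?C\<^sup>T *\<^sub>v \<mu> + ?E\<^sup>T *\<^sub>v \<eta>) @\<^sub>v (?B\<^sup>T *\<^sub>v l' + ?D\<^sup>T *\<^sub>v \<mu>)) @\<^sub>v (?T'\<^sup>T *\<^sub>v l')"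
    for l' \<mu> \<eta>
  define V where "V = {F l' \<mu> \<eta> | l' \<mu> \<eta>. dim_vec l' = sdim P (Suc i) \<and> dim_vec \<mu> = cdim P i \<and> dim_vec \<eta> = edim P i}"
  have VI: "F l' \<mu> \<eta> \<in> V"
    if "dim_vec l' = sdim P (Suc i)" "dim_vec \<mu> = cdim P i" "dim_vec \<eta> = edim P i" for l' \<mu> \<eta>
    unfolding V_def using that by blast
  have "vec_subspace (?n + ?m + ?k) V"
    unfolding vec_subspace_def
  proof (intro conjI ballI allI)
    show "V \<subseteq> carrier_vec (?n + ?m + ?k)" by (auto simp: V_def F_def)
    have "F (0\<^sub>v (sdim P (Suc i))) (0\<^sub>v (cdim P i)) (0\<^sub>v (edim P i)) = 0\<^sub>v (?n + ?m + ?k)"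
      unfolding F_def by (intro eq_vecI) auto
    then show "0\<^sub>v (?n + ?m + ?k) \<in> V"
      using VI[of "0\<^sub>v (sdim P (Suc i))" "0\<^sub>v (cdim P i)" "0\<^sub>v (edim P i)"] by simp
    fix a b c assume "a \<in> V" "b \<in> V"
    then obtain l1 \<mu>1 \<eta>1 l2 \<mu>2 \<eta>2 where a: "a = F l1 \<mu>1 \<eta>1" and b: "b = F l2 \<mu>2 \<eta>2"
      and [simp]: "dim_vec l1 = sdim P (Suc i)" "dim_vec \<mu>1 = cdim P i" "dim_vec \<eta>1 = edim P i"
        "dim_vec l2 = sdim P (Suc i)" "dim_vec \<mu>2 = cdim P i" "dim_vec \<eta>2 = edim P i"
      unfolding V_def by blast
    have "a + c \<cdot>\<^sub>v b = F (l1 + c \<cdot>\<^sub>v l2) (\<mu>1 + c \<cdot>\<^sub>v \<mu>2) (\<eta>1 + c \<cdot>\<^sub>v \<eta>2)"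
      unfolding a b F_def
      by (simp add: append_vec_combination append_vec_eq_iff, intro conjI eq_vecI)
         (simp_all add: mult_mat_vec_linear algebra_simps del: index_mult_mat_vec)
    then show "a + c \<cdot>\<^sub>v b \<in> V" by (simp add: VI)
  qed
  moreover define b where "b = ((l - gx) @\<^sub>v (- gu)) @\<^sub>v \<zeta>'"
  have "b \<in> carrier_vec (?n + ?m + ?k)" by (simp add: b_def)
  moreover have "b \<bullet> y = 0" if y: "y \<in> carrier_vec (?n + ?m + ?k)" and perp: "\<And>f. f \<in> V \<Longrightarrow> f \<bullet> y = 0" for y
  proof -
    obtain y' w where [simp]: "dim_vec y' = ?n + ?m" "dim_vec w = ?k" and yw: "y = y' @\<^sub>v w"
      using vec_split_append[of y "?n + ?m" ?k] y by auto
    obtain \<xi> \<omega> where [simp]: "dim_vec \<xi> = ?n" "dim_vec \<omega> = ?m" and y': "y' = \<xi> @\<^sub>v \<omega>"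
      using vec_split_append[of y' ?n ?m] by auto
    have perp': "l' \<bullet> (?A *\<^sub>v \<xi> + ?B *\<^sub>v \<omega> + ?T' *\<^sub>v w) + \<mu> \<bullet> (?C *\<^sub>v \<xi> + ?D *\<^sub>v \<omega>) + \<eta> \<bullet> (?E *\<^sub>v \<xi>) = 0"
      if [simp]: "dim_vec l' = sdim P (Suc i)" "dim_vec \<mu> = cdim P i" "dim_vec \<eta> = edim P i" for l' \<mu> \<eta>
    proof -
      have "F l' \<mu> \<eta> \<bullet> y = 0" by (rule perp, rule VI) simp_all
      then show ?thesis unfolding F_def yw y'
        by (simp add: scalar_prod_append_vec scalar_prod_linear scalar_prod_transpose)
    qed
    \<comment> \<open>The unknowns vary independently: setting two of them to zero isolates the
      factor of the third, here and in the next two facts.\<close>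
    have A0: "?A *\<^sub>v \<xi> + ?B *\<^sub>v \<omega> + ?T' *\<^sub>v w = 0\<^sub>v (sdim P (Suc i))"
      using vec_eq_0_if_orthogonal[of "?A *\<^sub>v \<xi> + ?B *\<^sub>v \<omega> + ?T' *\<^sub>v w"]
        perp'[of _ "0\<^sub>v (cdim P i)" "0\<^sub>v (edim P i)"] by simp
    have C0: "?C *\<^sub>v \<xi> + ?D *\<^sub>v \<omega> = 0\<^sub>v (cdim P i)"
      using vec_eq_0_if_orthogonal[of "?C *\<^sub>v \<xi> + ?D *\<^sub>v \<omega>"]
        perp'[of "0\<^sub>v (sdim P (Suc i))" _ "0\<^sub>v (edim P i)"] by simp
    have E0: "?E *\<^sub>v \<xi> = 0\<^sub>v (edim P i)"
      using vec_eq_0_if_orthogonal[of "?E *\<^sub>v \<xi>"]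
        perp'[of "0\<^sub>v (sdim P (Suc i))" "0\<^sub>v (cdim P i)"] by simp
    \<comment> \<open>Orthogonality puts \<open>w\<close> on the same side as the dynamics, so the
      direction of the reduced problem has successor minus \<open>w\<close>.\<close>
    have "?A *\<^sub>v \<xi> + ?B *\<^sub>v \<omega> = (?A *\<^sub>v \<xi> + ?B *\<^sub>v \<omega> + ?T' *\<^sub>v w) + ?T' *\<^sub>v ((-1) \<cdot>\<^sub>v w)"
      by (intro eq_vecI) (simp_all add: mult_mat_vec_linear del: index_mult_mat_vec)
    also have "\<dots> = ?T' *\<^sub>v ((-1) \<cdot>\<^sub>v w)" unfolding A0 by (intro eq_vecI) simp_all
    finally have A1: "?A *\<^sub>v \<xi> + ?B *\<^sub>v \<omega> = ?T' *\<^sub>v ((-1) \<cdot>\<^sub>v w)" .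
    obtain s r where [simp]: "dim_vec s = zdim K i" "dim_vec r = vdim K i" and \<xi>: "\<xi> = ?T *\<^sub>v s"
      and \<omega>: "\<omega> = matY K i *\<^sub>v s + matZ K i *\<^sub>v r" and w: "(-1) \<cdot>\<^sub>v w = ?A' *\<^sub>v s + ?B' *\<^sub>v r"
      by (rule direction_param[OF i z v _ _ _ E0 C0 A1]) simp_all
    have "\<zeta>' \<bullet> w = - (\<zeta>' \<bullet> ((-1) \<cdot>\<^sub>v w))" by (simp add: scalar_prod_linear)
    also have "\<dots> = - (\<zeta>' \<bullet> (?A' *\<^sub>v s)) - \<zeta>' \<bullet> (?B' *\<^sub>v r)"
      unfolding w by (simp add: scalar_prod_linear del: reduced_simps)
    finally have ww: "\<zeta>' \<bullet> w = - (\<zeta>' \<bullet> (?A' *\<^sub>v s)) - \<zeta>' \<bullet> (?B' *\<^sub>v r)" .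
    have "l \<bullet> \<xi> = (?T\<^sup>T *\<^sub>v l) \<bullet> s" unfolding \<xi> by (simp add: scalar_prod_transpose)
    also have "\<dots> = gx \<bullet> \<xi> + gu \<bullet> (matY K i *\<^sub>v s) + \<zeta>' \<bullet> (?A' *\<^sub>v s)"
      unfolding \<zeta>_eq \<xi> by (simp add: scalar_prod_linear scalar_prod_transpose del: reduced_simps)
    finally have lx: "l \<bullet> \<xi> = gx \<bullet> \<xi> + gu \<bullet> (matY K i *\<^sub>v s) + \<zeta>' \<bullet> (?A' *\<^sub>v s)" .
    \<comment> \<open>The terms in \<open>s\<close> cancel by the adjoint equation for
      \<open>l\<close>. What remains is the control stationarity of the reduced problem tested with
      \<open>r\<close>.\<close>
    have "((matZ K i)\<^sup>T *\<^sub>v gu + ?B'\<^sup>T *\<^sub>v \<zeta>') \<bullet> r = gu \<bullet> (matZ K i *\<^sub>v r) + \<zeta>' \<bullet> (?B' *\<^sub>v r)"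
      by (simp add: scalar_prod_linear scalar_prod_transpose del: reduced_simps)
    then have Zr: "gu \<bullet> (matZ K i *\<^sub>v r) + \<zeta>' \<bullet> (?B' *\<^sub>v r) = 0" unfolding opt_eq by simp
    have "gu \<bullet> \<omega> = gu \<bullet> (matY K i *\<^sub>v s) + gu \<bullet> (matZ K i *\<^sub>v r)"
      unfolding \<omega> by (simp add: scalar_prod_linear)
    moreover have "b \<bullet> y = l \<bullet> \<xi> - gx \<bullet> \<xi> - gu \<bullet> \<omega> + \<zeta>' \<bullet> w"
      unfolding b_def yw y' by (simp add: scalar_prod_append_vec scalar_prod_linear)
    ultimately show ?thesis using ww lx Zr by linarith
  qed
  ultimately have "b \<in> V" by (rule vec_subspace_double_perp)
  then obtain l' \<mu> \<eta> where b: "b = F l' \<mu> \<eta>"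
    and l'd: "dim_vec l' = sdim P (Suc i)" and [simp]: "dim_vec \<mu> = cdim P i" "dim_vec \<eta> = edim P i"
    unfolding V_def by blast
  note [simp] = l'd
  from b have 1: "?A\<^sup>T *\<^sub>v l' + ?C\<^sup>T *\<^sub>v \<mu> + ?E\<^sup>T *\<^sub>v \<eta> = l - gx" and 2: "?B\<^sup>T *\<^sub>v l' + ?D\<^sup>T *\<^sub>v \<mu> = - gu"
    and 3: "?T'\<^sup>T *\<^sub>v l' = \<zeta>'"
    unfolding b_def F_def by (simp_all add: append_vec_eq_iff)
  have "gx - l + ?A\<^sup>T *\<^sub>v l' + ?C\<^sup>T *\<^sub>v \<mu> + ?E\<^sup>T *\<^sub>v \<eta> = (gx - l) + (?A\<^sup>T *\<^sub>v l' + ?C\<^sup>T *\<^sub>v \<mu> + ?E\<^sup>T *\<^sub>v \<eta>)"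
    by (intro eq_vecI) simp_all
  also have "\<dots> = 0\<^sub>v ?n" unfolding 1 by (intro eq_vecI) simp_all
  finally have s1: "gx - l + ?A\<^sup>T *\<^sub>v l' + ?C\<^sup>T *\<^sub>v \<mu> + ?E\<^sup>T *\<^sub>v \<eta> = 0\<^sub>v ?n" .
  have "gu + ?B\<^sup>T *\<^sub>v l' + ?D\<^sup>T *\<^sub>v \<mu> = gu + (?B\<^sup>T *\<^sub>v l' + ?D\<^sup>T *\<^sub>v \<mu>)"
    by (intro eq_vecI) simp_all
  also have "\<dots> = 0\<^sub>v ?m" unfolding 2 by (intro eq_vecI) simp_all
  finally have s2: "gu + ?B\<^sup>T *\<^sub>v l' + ?D\<^sup>T *\<^sub>v \<mu> = 0\<^sub>v ?m" .
  have "stationary P x u i l l' \<mu> \<eta>"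
    unfolding stationary_def using s1 s2 by (simp only: gx_def gu_def) simp
  then show ?thesis using that l'd 3 by blast
qed

text \<open>The invariant makes \<open>l - g\<close> orthogonal to the range of \<open>matT\<close>
  at the horizon. That range contains the kernel of \<open>matE\<close>, so \<open>l - g\<close>
  lies in the range of the transpose of \<open>matE\<close>.\<close>

lemma terminal_multiplier_exists:
  assumes z: "dim_vec (z (hor P)) = zdim K (hor P)" and l: "dim_vec l = sdim P (hor P)"
  defines "x \<equiv> recover_x K z"
  assumes \<zeta>: "(matT K (hor P))\<^sup>T *\<^sub>v l = grad_end (reduced_lqr P K) z"
  obtains \<eta> where "terminal_stationary P x l \<eta>"
proof -
  note [simp] = z l
  let ?N = "hor P"
  let ?T = "matT K ?N" and ?E = "matE P ?N"
  define g where "g = grad_end P x"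
  have [simp]: "dim_vec (x ?N) = sdim P ?N" by (simp add: x_def recover_x_def)
  have [simp]: "dim_vec g = sdim P ?N" by (simp add: g_def)
  have T: "?T\<^sup>T *\<^sub>v l = ?T\<^sup>T *\<^sub>v g" unfolding \<zeta> g_def x_def by (rule reduced_end_gradient) simp
  define V where "V = {?E\<^sup>T *\<^sub>v \<eta> | \<eta>. dim_vec \<eta> = edim P ?N}"
  have VI: "?E\<^sup>T *\<^sub>v \<eta> \<in> V" if "dim_vec \<eta> = edim P ?N" for \<eta>
    unfolding V_def using that by blast
  have "vec_subspace (sdim P ?N) V"
    unfolding vec_subspace_def
  proof (intro conjI ballI allI)
    show "V \<subseteq> carrier_vec (sdim P ?N)" by (auto simp: V_def)
    have "?E\<^sup>T *\<^sub>v 0\<^sub>v (edim P ?N) = 0\<^sub>v (sdim P ?N)" by (intro eq_vecI) auto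
    then show "0\<^sub>v (sdim P ?N) \<in> V" using VI[of "0\<^sub>v (edim P ?N)"] by simp
    fix a b c assume "a \<in> V" "b \<in> V"
    then obtain \<eta>1 \<eta>2 where a: "a = ?E\<^sup>T *\<^sub>v \<eta>1" and b: "b = ?E\<^sup>T *\<^sub>v \<eta>2"
      and [simp]: "dim_vec \<eta>1 = edim P ?N" "dim_vec \<eta>2 = edim P ?N"
      unfolding V_def by blast
    have "a + c \<cdot>\<^sub>v b = ?E\<^sup>T *\<^sub>v (\<eta>1 + c \<cdot>\<^sub>v \<eta>2)" unfolding a b by (simp add: mult_mat_vec_linear)
    then show "a + c \<cdot>\<^sub>v b \<in> V" by (simp add: VI)
  qed
  moreover have "l - g \<in> carrier_vec (sdim P ?N)" by simp
  moreover have "(l - g) \<bullet> \<xi> = 0" if \<xi>: "\<xi> \<in> carrier_vec (sdim P ?N)" and perp: "\<And>f. f \<in> V \<Longrightarrow> f \<bullet> \<xi> = 0" for \<xi>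
  proof -
    have [simp]: "dim_vec \<xi> = sdim P ?N" using \<xi> by simp
    have "\<eta> \<bullet> (?E *\<^sub>v \<xi>) = 0" if [simp]: "dim_vec \<eta> = edim P ?N" for \<eta>
    proof -
      have "(?E\<^sup>T *\<^sub>v \<eta>) \<bullet> \<xi> = 0" by (rule perp, rule VI) simp
      then show ?thesis by (simp add: scalar_prod_transpose)
    qed
    then have E0: "?E *\<^sub>v \<xi> = 0\<^sub>v (edim P ?N)" using vec_eq_0_if_orthogonal[of "?E *\<^sub>v \<xi>"] by simp
    have dom: "x ?N \<in> suffix_domain P ?N" unfolding x_def recover_x_def by (rule suffix_domain_param) simp_all
    have "?E *\<^sub>v (x ?N + \<xi>) + vece P ?N = (?E *\<^sub>v x ?N + vece P ?N) + ?E *\<^sub>v \<xi>"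
      by (intro eq_vecI) (simp_all add: mult_mat_vec_linear del: index_mult_mat_vec)
    also have "?E *\<^sub>v x ?N + vece P ?N = 0\<^sub>v (edim P ?N)"
      using dom by (simp add: suffix_domain_hor state_constraint_def)
    also have "0\<^sub>v (edim P ?N) + ?E *\<^sub>v \<xi> = 0\<^sub>v (edim P ?N)" unfolding E0 by (intro eq_vecI) simp_all
    finally have "x ?N + \<xi> \<in> suffix_domain P ?N" by (simp add: suffix_domain_hor state_constraint_def)
    then have "matH K ?N *\<^sub>v ((x ?N + \<xi>) - x ?N) = 0\<^sub>v (dim_row (matH K ?N))"
      using dom by (intro affine_kernel_diff[where h = "vech K ?N"]) (simp_all add: suffix_domain_iff)
    moreover have "(x ?N + \<xi>) - x ?N = \<xi>" by (intro eq_vecI) simp_all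
    ultimately have H: "matH K ?N *\<^sub>v \<xi> = 0\<^sub>v (dim_row (matH K ?N))" by simp
    define s where "s = matS K ?N *\<^sub>v \<xi>"
    have [simp]: "dim_vec s = zdim K ?N" by (simp add: s_def)
    have \<xi>s: "\<xi> = ?T *\<^sub>v s" unfolding s_def using kernel_param(2)[OF _ _ H] by simp
    have "l \<bullet> \<xi> = (?T\<^sup>T *\<^sub>v l) \<bullet> s" "g \<bullet> \<xi> = (?T\<^sup>T *\<^sub>v g) \<bullet> s"
      unfolding \<xi>s by (simp_all add: scalar_prod_transpose)
    then have "l \<bullet> \<xi> = g \<bullet> \<xi>" unfolding T by simp
    then show ?thesis by (simp add: scalar_prod_linear)
  qed
  ultimately have "l - g \<in> V" by (rule vec_subspace_double_perp)
  then obtain \<eta> where [simp]: "dim_vec \<eta> = edim P ?N" and \<eta>: "?E\<^sup>T *\<^sub>v \<eta> = l - g" unfolding V_def by auto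
  have "g - l + ?E\<^sup>T *\<^sub>v \<eta> = 0\<^sub>v (sdim P ?N)" unfolding \<eta> by (intro eq_vecI) simp_all
  then have "terminal_stationary P x l \<eta>" by (simp add: terminal_stationary_def g_def)
  then show ?thesis by (rule that)
qed

lemma multipliers_exist:
  assumes m: "lqr_minimizer (reduced_lqr P K) z v"
  obtains lam \<mu> \<eta> where "\<And>i. i \<le> hor P \<Longrightarrow> dim_vec (lam i) = sdim P i"
    "solves_stationarity P (recover_x K z) (recover_u K z v) lam \<mu> \<eta>"
proof -
  let ?R = "reduced_lqr P K" and ?N = "hor P"
  have zd: "dim_vec (z i) = zdim K i" if "i \<le> ?N" for i
    using m that by (simp add: lqr_minimizer_def lqr_feasible_def suffix_feasible_def)
  have vd: "dim_vec (v i) = vdim K i" if "i < ?N" for i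
    using m that by (simp add: lqr_minimizer_def lqr_feasible_def suffix_feasible_def)
  have "\<exists>\<zeta>. (\<forall>i\<le>hor ?R. dim_vec (\<zeta> i) = sdim ?R i) \<and> \<zeta> (hor ?R) = grad_end ?R z \<and>
    (\<forall>i<hor ?R. \<zeta> i = grad_x ?R z v i + (matA ?R i)\<^sup>T *\<^sub>v \<zeta> (Suc i) \<and>
      grad_u ?R z v i + (matB ?R i)\<^sup>T *\<^sub>v \<zeta> (Suc i) = 0\<^sub>v (udim ?R i))"
    by (rule unconstrained_adjoint[OF reduced_problem m]) simp_all
  then obtain \<zeta> where \<zeta>: "\<And>i. i \<le> hor ?R \<Longrightarrow> dim_vec (\<zeta> i) = sdim ?R i" "\<zeta> (hor ?R) = grad_end ?R z"
    "\<And>i. i < hor ?R \<Longrightarrow> \<zeta> i = grad_x ?R z v i + (matA ?R i)\<^sup>T *\<^sub>v \<zeta> (Suc i)"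
    "\<And>i. i < hor ?R \<Longrightarrow> grad_u ?R z v i + (matB ?R i)\<^sup>T *\<^sub>v \<zeta> (Suc i) = 0\<^sub>v (udim ?R i)"
    by blast
  \<comment> \<open>Dependent choice produces an infinite sequence, so the conditions are guarded by
    the horizon and zero vectors continue the sequence beyond it.\<close>
  define good where "good i l \<longleftrightarrow> dim_vec l = sdim P i \<and> (i \<le> ?N \<longrightarrow> (matT K i)\<^sup>T *\<^sub>v l = \<zeta> i)" for i l
  define link where "link i l l' \<longleftrightarrow>
    (i < ?N \<longrightarrow> (\<exists>\<mu> \<eta>. stationary P (recover_x K z) (recover_u K z v) i l l' \<mu> \<eta>))" for i l l'
  have "\<exists>l. good 0 l"
  proof -
    \<comment> \<open>The start is \<open>\<zeta> 0\<close> lifted by the transpose of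
      \<open>matS K 0\<close>, since transposing the left inverse property gives a right inverse of
      the transpose of \<open>matT K 0\<close>.\<close>
    have "(matT K 0)\<^sup>T *\<^sub>v ((matS K 0)\<^sup>T *\<^sub>v \<zeta> 0) = (matS K 0 * matT K 0)\<^sup>T *\<^sub>v \<zeta> 0"
      using \<zeta>(1)[of 0] by (simp add: transpose_mat_mult mult_mat_mult_vec)
    also have "matS K 0 * matT K 0 = 1\<^sub>m (zdim K 0)" using param by (simp add: valid_param_def)
    finally show ?thesis
      unfolding good_def using \<zeta>(1)[of 0] by (intro exI[of _ "(matS K 0)\<^sup>T *\<^sub>v \<zeta> 0"]) simp
  qed
  moreover have "\<exists>l'. good (Suc i) l' \<and> link i l l'" if g: "good i l" for l i
  proof (cases "i < ?N")
    case True
    obtain l' \<mu> \<eta> where "dim_vec l' = sdim P (Suc i)"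
      "stationary P (recover_x K z) (recover_u K z v) i l l' \<mu> \<eta>" "(matT K (Suc i))\<^sup>T *\<^sub>v l' = \<zeta> (Suc i)"
    proof (rule stage_multipliers_exist[of i z v l "\<zeta> (Suc i)"])
      show "(matT K i)\<^sup>T *\<^sub>v l = grad_x ?R z v i + (matA ?R i)\<^sup>T *\<^sub>v \<zeta> (Suc i)"
        using g True \<zeta>(3)[of i] by (simp add: good_def del: reduced_simps(7-9))
      show "grad_u ?R z v i + (matB ?R i)\<^sup>T *\<^sub>v \<zeta> (Suc i) = 0\<^sub>v (vdim K i)"
        using True \<zeta>(4)[of i] by (simp del: reduced_simps(7-9))
    qed (use True zd vd \<zeta>(1)[of "Suc i"] g in \<open>simp_all add: good_def\<close>)
    then show ?thesis unfolding good_def link_def by blast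
  next
    case False
    then show ?thesis
      by (intro exI[of _ "0\<^sub>v (sdim P (Suc i))"]) (simp add: good_def link_def)
  qed
  ultimately obtain lam where lam: "\<And>i. good i (lam i)" "\<And>i. link i (lam i) (lam (Suc i))"
    using dependent_nat_choice[of good link] by blast
  have "\<forall>i. \<exists>\<mu> \<eta>. i < ?N \<longrightarrow> stationary P (recover_x K z) (recover_u K z v) i (lam i) (lam (Suc i)) \<mu> \<eta>"
    using lam(2) unfolding link_def by blast
  then obtain \<mu> \<eta> where st: "\<And>i. i < ?N \<Longrightarrow>
      stationary P (recover_x K z) (recover_u K z v) i (lam i) (lam (Suc i)) (\<mu> i) (\<eta> i)"
    by metis
  obtain \<eta>N where "terminal_stationary P (recover_x K z) (lam ?N) \<eta>N"
    by (rule terminal_multiplier_exists[of z "lam ?N"]) (use lam(1)[of ?N] zd \<zeta>(2) in \<open>simp_all add: good_def\<close>)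
  \<comment> \<open>The stage equations use \<open>\<eta>\<close> only below the horizon, so its
    value there is free for the terminal multiplier.\<close>
  then have "solves_stationarity P (recover_x K z) (recover_u K z v) lam \<mu> (\<eta>(?N := \<eta>N))"
    unfolding solves_stationarity_def using st by simp
  moreover have "dim_vec (lam i) = sdim P i" for i using lam(1)[of i] by (simp add: good_def)
  ultimately show ?thesis using that by blast
qed

end

section \<open>Correctness of the contraction-expansion procedure\<close>

theorem proposition7:
  fixes P :: lqr and K :: param and z v x u :: "nat \<Rightarrow> real vec" and \<tau> :: "nat tree"
  assumes "lqr_problem P"
    and "valid_param P K"
    and "matH K 0 *\<^sub>v init P + vech K 0 = 0\<^sub>v (dim_row (matH K 0))"
    and "lqr_minimizer (reduced_lqr P K) z v"
    and "x = recover_x K z"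
    and "u = recover_u K z v"
    and "stage_tree (hor P) \<tau>"
  shows "(\<exists>\<P> \<p> \<Z>. contraction P x u \<tau> \<P> \<p> \<Z>) \<and>
         root_feasible P x u \<tau> \<noteq> {} \<and>
         (\<forall>\<P> \<p> \<Z>. contraction P x u \<tau> \<P> \<p> \<Z> \<longrightarrow>
           (\<forall>lam0 \<in> root_feasible P x u \<tau>.
             let lam = expansion P \<tau> \<P> \<p> \<Z> lam0 in
               (\<exists>\<mu> \<eta>. solves_stationarity P x u lam \<mu> \<eta>) \<and>
               (\<forall>\<mu> \<eta> \<alpha>. solves_stationarity P x u lam \<mu> \<eta> \<and> \<alpha> = - lam0 \<longrightarrow>
                  kkt P x u lam \<mu> \<eta> \<alpha>)))"
proof -
  interpret parametrized_lqr P K using assms(1,2) by unfold_locales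
  let ?N = "hor P"
  have tree: "inorder \<tau> = [Suc 0..<Suc ?N]" using assms(7) by (simp add: stage_tree_def)
  have feas: "lqr_feasible P x u"
    unfolding assms(5,6) using assms(3,4) by (intro recovered_feasible) (simp_all add: lqr_minimizer_def)
  then have dims: "\<And>i. i \<le> ?N \<Longrightarrow> dim_vec (x i) = sdim P i" "\<And>i. i < ?N \<Longrightarrow> dim_vec (u i) = udim P i"
    by (simp_all add: lqr_feasible_def suffix_feasible_def)
  have aff: "affine_rel (costate_dim P i) (costate_dim P (Suc i)) (leaf_rel P x u i)" if "i < Suc ?N" for i
    using that dims assms(1) by (intro affine_leaf_rel) simp_all
  have leaf: "(l, l') \<in> leaf_rel P x u i \<longleftrightarrow> dim_vec l = sdim P i \<and> dim_vec l' = sdim P (Suc i) \<and>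
      (\<exists>\<mu> \<eta>. stationary P x u i l l' \<mu> \<eta>)" if "i < ?N" for i l l'
    using that by (simp add: leaf_rel_def costate_dim_def Suc_le_eq)
  have leafN: "(l, l') \<in> leaf_rel P x u ?N \<longleftrightarrow> dim_vec l = sdim P ?N \<and> dim_vec l' = 0 \<and>
      (\<exists>\<eta>. terminal_stationary P x l \<eta>)" for l l'
    by (simp add: leaf_rel_def costate_dim_def)
  have "\<exists>\<P> \<p> \<Z>. contraction P x u \<tau> \<P> \<p> \<Z>"
    unfolding contraction_def by (rule solution_maps_exist[OF _ tree]) (simp_all add: aff)
  moreover have "root_feasible P x u \<tau> \<noteq> {}"
  proof -
    obtain lam \<mu> \<eta> where lam: "\<And>i. i \<le> ?N \<Longrightarrow> dim_vec (lam i) = sdim P i" "solves_stationarity P x u lam \<mu> \<eta>"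
      unfolding assms(5,6) using multipliers_exist[OF assms(4)] by blast
    \<comment> \<open>The last relation needs the dummy endpoint at index
      \<open>Suc (hor P)\<close>.\<close>
    define lam' where "lam' = lam(Suc ?N := 0\<^sub>v 0)"
    have "(lam' i, lam' (Suc i)) \<in> leaf_rel P x u i" if "i < Suc ?N" for i
    proof (cases "i = ?N")
      case True
      then show ?thesis using lam by (auto simp: leafN lam'_def solves_stationarity_def)
    next
      case False
      then have "i < ?N" using that by simp
      moreover from this have "stationary P x u i (lam i) (lam (Suc i)) (\<mu> i) (\<eta> i)"
        using lam(2) by (simp add: solves_stationarity_def)
      ultimately show ?thesis using lam(1) by (simp add: leaf lam'_def) blast
    qed
    then have "(lam' 0, lam' (Suc ?N)) \<in> tree_rel (leaf_rel P x u) 0 \<tau>"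
      by (intro tree_rel_if_chain[OF _ tree]) simp_all
    then show ?thesis unfolding root_feasible_def by blast
  qed
  moreover have "(\<exists>\<mu> \<eta>. solves_stationarity P x u lam \<mu> \<eta>) \<and>
      (\<forall>\<mu> \<eta> \<alpha>. solves_stationarity P x u lam \<mu> \<eta> \<and> \<alpha> = - lam0 \<longrightarrow> kkt P x u lam \<mu> \<eta> \<alpha>)"
    if c: "contraction P x u \<tau> \<P> \<p> \<Z>" and r: "lam0 \<in> root_feasible P x u \<tau>"
      and lam: "lam = expansion P \<tau> \<P> \<p> \<Z> lam0" for \<P> \<p> \<Z> lam0 lam
  proof -
    define start where "start = (\<lambda>_ :: nat. 0\<^sub>v 0 :: real vec)(0 := lam0)"
    obtain e where e: "(lam0, e) \<in> tree_rel (leaf_rel P x u) 0 \<tau>" using r by (auto simp: root_feasible_def)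
    have "affine_rel (costate_dim P 0) (costate_dim P (Suc ?N)) (tree_rel (leaf_rel P x u) 0 \<tau>)"
      by (rule affine_tree_rel[OF _ tree]) (simp_all add: aff)
    then have "dim_vec e = costate_dim P (Suc ?N)" using e by (rule affine_relD(2))
    \<comment> \<open>The dummy endpoint has only one possible value, the one with which the
      expansion is initialized.\<close>
    then have "e = 0\<^sub>v 0" by (intro eq_vecI) (simp_all add: costate_dim_def)
    then have "(start 0, start (Suc ?N)) \<in> tree_rel (leaf_rel P x u) 0 \<tau>" using e by (simp add: start_def)
    then have chain: "(lam i, lam (Suc i)) \<in> leaf_rel P x u i" if "i < Suc ?N" for i
      unfolding lam expansion_def start_def[symmetric]
      using c that unfolding contraction_def by (intro expand_chain[OF _ tree]) simp_all
    have lam0: "lam 0 = lam0"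
      unfolding lam expansion_def by (subst expand_outside[OF tree]) simp_all
    have ld: "dim_vec (lam i) = sdim P i" if "i \<le> ?N" for i
      using that chain[of i] by (cases "i = ?N") (simp_all add: leaf leafN)
    have "\<forall>i. \<exists>\<mu> \<eta>. i < ?N \<longrightarrow> stationary P x u i (lam i) (lam (Suc i)) \<mu> \<eta>"
      using chain leaf by (meson less_SucI)
    then obtain \<mu> \<eta> where st: "\<And>i. i < ?N \<Longrightarrow> stationary P x u i (lam i) (lam (Suc i)) (\<mu> i) (\<eta> i)"
      by metis
    obtain \<eta>N where "terminal_stationary P x (lam ?N) \<eta>N" using chain[of ?N] by (auto simp: leafN)
    then have "solves_stationarity P x u lam \<mu> (\<eta>(?N := \<eta>N))"
      unfolding solves_stationarity_def using st by simp
    moreover have "kkt P x u lam \<mu> \<eta> (- lam0)" if "solves_stationarity P x u lam \<mu> \<eta>" for \<mu> \<eta>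
    proof -
      \<comment> \<open>The expansion never overwrites index 0, so the formal initial costate in
        \<open>kkt\<close> is the chosen \<open>lam0\<close>.\<close>
      have "lam(0 := - (- lam0)) = lam" using lam0 by auto
      then show ?thesis unfolding kkt_def using feas that ld ld[of 0] lam0 by simp
    qed
    ultimately show ?thesis by blast
  qed
  ultimately show ?thesis unfolding Let_def by blast
qed

end
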